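(* Let the standing assumptions on $A$, $Q$, $W^Q$, $X_0$ and $F$ stated in the context hold, let $0<\tau<\tau_0\le\frac{\lambda_1-L_F}{4L^2}$ and $n\in\mathbb{N}$. Then the Markov chain $\{Y_m^n\}_{m\in\mathbb{N}}$ given by the exponential Euler scheme $$Y_m^n=E_n(\tau)Y_{m-1}^n+\tau E_n(\tau)P_nF(Y_{m-1}^n)+E_n(\tau)P_n\Delta W_{m-1}^Q,\qquad Y_0^n=P_nX_0,$$ is ergodic with a unique invariant measure $\nu_\tau^n$.
   Context: Setting. $(H,\langle\cdot,\cdot\rangle,\|\cdot\|)$ is a real separable Hilbert space; $\mathcal{L}(H)$ and $\mathcal{L}_2(H)$ denote bounded linear and Hilbert--Schmidt operators on $H$; $\mathbb{N}=\{1,2,\dots\}$. Assumption on $A$: $A:\mathcal{D}(A)\subset H\to H$ is a densely defined, self-adjoint, negative definite linear operator, not necessarily bounded but with compact inverse. Hence there are an orthonormal basis $\{e_i\}_{i\in\mathbb{N}}$ of $H$ and reals $0<\lambda_1\le\lambda_2\le\cdots\to\infty$ with $-Ae_i=\lambda_ie_i$. Fractional powers $(-A)^\gamma$, $\gamma\in\mathbb{R}$, are defined spectrally; $\dot H^\gamma=\mathcal{D}((-A)^{\gamma/2})$ with norm $\|\varphi\|_\gamma=\|(-A)^{\gamma/2}\varphi\|$. Assumptions on $Q,W^Q,X_0,F$: $\{W^Q(t)\}_{t\ge0}$ is a cylindrical $Q$-Wiener process on a filtered probability space $(\Omega,\mathcal{F},\mathbb{P};\{\mathcal{F}_t\}_{t\ge0})$,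 where $Q:H\to H$ is a self-adjoint, positive definite bounded linear operator commuting with $A$, so that $Qe_i=q_ie_i$ and $W^Q(t)=\sum_{i=1}^\infty\sqrt{q_i}\,\beta_i(t)e_i$ with independent real Brownian motions $\beta_i$; and $\|(-A)^{\frac{\beta-1}{2}}Q^{1/2}\|_{\mathcal{L}_2(H)}<\infty$ for some $\beta\in(0,1]$. The initial value $X_0\in\dot H^{\max(2\beta,1)}$ is deterministic. The map $F:H\to H$ is twice differentiable and satisfies $\langle\varphi_1-\varphi_2,F(\varphi_1)-F(\varphi_2)\rangle\le L_F\|\varphi_1-\varphi_2\|^2$ for all $\varphi_1,\varphi_2\in H$, with $L_F<\lambda_1$; and there are $L>0$, $\delta\in[1,2)$, $\eta\in[0,1)$ with $\|F'(\varphi)\psi\|\le L\|\psi\|$ for $\varphi,\psi\in H$; $\|(-A)^{-\delta/2}F'(\varphi)\psi\|\le L(1+\|\varphi\|_1)\|\psi\|_{-1}$ for $\varphi\in\dot H^1,\psi\in H$; $\|(-A)^{-\eta}F''(\varphi)(\psi_1,\psi_2)\|\le L\|\psi_1\|\|\psi_2\|$ for $\varphi,\psi_1,\psi_2\in H$. Discretization notation: $H_n=\mathrm{span}\{e_1,\dots,e_n\}$, $P_n\varphi=\sum_{i=1}^n\langle e_i,\varphi\rangle e_i$, $A_n=AP_n:H_n\to H_n$, $E_n(t)=e^{tA_n}$. $\tau>0$ is the uniform time stepsize, $t_m=m\tau$, and $E_n(\tau)P_n\Delta W_{m-1}^Q=\int_{t_{m-1}}^{t_m}E_n(\tau)P_n\,\mathrm{d}W^Q(s)$.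 Ergodicity of the chain: with the one-step transition operator $P\Phi(x)=\mathbb{E}[\Phi(Y_1^n)\mid Y_0^n=x]$, $x\in H_n$, a probability measure $\mu$ on $(H_n,\mathcal{B}(H_n))$ is invariant if $\int_{H_n} P\Phi\,\mathrm{d}\mu=\int_{H_n}\Phi\,\mathrm{d}\mu$ for all bounded Borel $\Phi$; the chain is ergodic if $\frac1M\sum_{m=0}^{M-1}P^m\Phi\to\int_{H_n}\Phi\,\mathrm{d}\mu$ in $L^2(H_n,\mu)$ as $M\to\infty$ for all $\Phi\in L^2(H_n,\mu)$. *)

theory Defs
  imports "HOL-Probability.Probability"
begin

section \<open>Operators on a real Hilbert space\<close>

text \<open>
  Sequences are indexed from 0: \<open>e i\<close>, \<open>lam i\<close>, \<open>q i\<close> and \<open>B i\<close> stand for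
  $e_{i+1}$, $\lambda_{i+1}$, $q_{i+1}$ and $\beta_{i+1}$; in particular \<open>lam 0\<close> is $\lambda_1$.
\<close>

definition orthonormal_basis :: "(nat \<Rightarrow> 'a::real_inner) \<Rightarrow> bool" where
  "orthonormal_basis e \<longleftrightarrow>
     (\<forall>i j. e i \<bullet> e j = (if i = j then 1 else 0)) \<and> closure (span (range e)) = UNIV"

text \<open>
  An unbounded operator is a function together with its domain \<open>D\<close>; its values outside \<open>D\<close>
  are irrelevant.
\<close>

definition densely_defined_linear :: "'a::real_inner set \<Rightarrow> ('a \<Rightarrow> 'a) \<Rightarrow> bool" where
  "densely_defined_linear D A \<longleftrightarrow> subspace D \<and> closure D = UNIV \<and>
     (\<forall>x\<in>D. \<forall>y\<in>D. A (x + y) = A x + A y) \<and> (\<forall>c. \<forall>x\<in>D. A (c *\<^sub>R x) = c *\<^sub>R A x)"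

text \<open>The graph of the adjoint (left-hand side) coincides with the graph of the operator.\<close>

definition self_adjoint_on :: "'a::real_inner set \<Rightarrow> ('a \<Rightarrow> 'a) \<Rightarrow> bool" where
  "self_adjoint_on D A \<longleftrightarrow> (\<forall>y z. (\<forall>x\<in>D. A x \<bullet> y = x \<bullet> z) \<longleftrightarrow> y \<in> D \<and> z = A y)"

definition negative_definite_on :: "'a::real_inner set \<Rightarrow> ('a \<Rightarrow> 'a) \<Rightarrow> bool" where
  "negative_definite_on D A \<longleftrightarrow> (\<forall>x\<in>D. x \<noteq> 0 \<longrightarrow> A x \<bullet> x < 0)"

definition positive_definite_on :: "'a::real_inner set \<Rightarrow> ('a \<Rightarrow> 'a) \<Rightarrow> bool" where
  "positive_definite_on D A \<longleftrightarrow> (\<forall>x\<in>D. x \<noteq> 0 \<longrightarrow> A x \<bullet> x > 0)"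

definition compact_operator :: "('a::real_normed_vector \<Rightarrow> 'a) \<Rightarrow> bool" where
  "compact_operator T \<longleftrightarrow> linear T \<and> (\<forall>S. bounded S \<longrightarrow> compact (closure (T ` S)))"

definition has_compact_inverse :: "'a::real_normed_vector set \<Rightarrow> ('a \<Rightarrow> 'a) \<Rightarrow> bool" where
  "has_compact_inverse D A \<longleftrightarrow> bij_betw A D UNIV \<and> compact_operator (inv_into D A)"

text \<open>A bounded operator commuting with an unbounded one.\<close>

definition commutes_with :: "'a::real_normed_vector set \<Rightarrow> ('a \<Rightarrow> 'a) \<Rightarrow> ('a \<Rightarrow> 'a) \<Rightarrow> bool" where
  "commutes_with D A Q \<longleftrightarrow> (\<forall>x\<in>D. Q x \<in> D \<and> A (Q x) = Q (A x))"

text \<open>The sum in the Hilbert-Schmidt norm does not depend on the orthonormal basis.\<close>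

definition hilbert_schmidt :: "('a::real_inner \<Rightarrow> 'a) \<Rightarrow> bool" where
  "hilbert_schmidt T \<longleftrightarrow> bounded_linear T \<and>
     (\<exists>b. orthonormal_basis b \<and> summable (\<lambda>i. (norm (T (b i)))\<^sup>2))"

text \<open>Spectral calculus: the operator with eigenvalues \<open>w i\<close> on the eigenvectors \<open>e i\<close>.\<close>

definition spectral_domain :: "(nat \<Rightarrow> 'a::real_inner) \<Rightarrow> (nat \<Rightarrow> real) \<Rightarrow> 'a set" where
  "spectral_domain e w = {x. summable (\<lambda>i. (w i * (e i \<bullet> x))\<^sup>2)}"

definition spectral_op :: "(nat \<Rightarrow> 'a::real_inner) \<Rightarrow> (nat \<Rightarrow> real) \<Rightarrow> 'a \<Rightarrow> 'a" where
  "spectral_op e w x = (\<Sum>i. (w i * (e i \<bullet> x)) *\<^sub>R e i)"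

text \<open>The fractional power $(-A)^\gamma$, where $-A e_i = \lambda_i e_i$.\<close>

definition frac_pow :: "(nat \<Rightarrow> 'a::real_inner) \<Rightarrow> (nat \<Rightarrow> real) \<Rightarrow> real \<Rightarrow> 'a \<Rightarrow> 'a" where
  "frac_pow e lam \<gamma> = spectral_op e (\<lambda>i. lam i powr \<gamma>)"

definition Hdot :: "(nat \<Rightarrow> 'a::real_inner) \<Rightarrow> (nat \<Rightarrow> real) \<Rightarrow> real \<Rightarrow> 'a set" where
  "Hdot e lam \<gamma> = spectral_domain e (\<lambda>i. lam i powr (\<gamma> / 2))"

definition Hdot_norm :: "(nat \<Rightarrow> 'a::real_inner) \<Rightarrow> (nat \<Rightarrow> real) \<Rightarrow> real \<Rightarrow> 'a \<Rightarrow> real" where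
  "Hdot_norm e lam \<gamma> x = norm (frac_pow e lam (\<gamma> / 2) x)"

definition galerkin_space :: "(nat \<Rightarrow> 'a::real_inner) \<Rightarrow> nat \<Rightarrow> 'a set" where
  "galerkin_space e n = span (e ` {..<n})"

definition galerkin_proj :: "(nat \<Rightarrow> 'a::real_inner) \<Rightarrow> nat \<Rightarrow> 'a \<Rightarrow> 'a" where
  "galerkin_proj e n x = (\<Sum>i<n. (e i \<bullet> x) *\<^sub>R e i)"

text \<open>$E_n(t) = e^{t A_n}$ with $A_n = A P_n$, as an exponential series on $H_n$.\<close>

definition galerkin_semigroup ::
  "('a::real_inner \<Rightarrow> 'a) \<Rightarrow> (nat \<Rightarrow> 'a) \<Rightarrow> nat \<Rightarrow> real \<Rightarrow> 'a \<Rightarrow> 'a" where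
  "galerkin_semigroup A e n t x =
     (\<Sum>k. (t ^ k / fact k) *\<^sub>R ((\<lambda>y. A (galerkin_proj e n y)) ^^ k) x)"

section \<open>Brownian motions and the noise\<close>

definition filtration_on :: "'w measure \<Rightarrow> (real \<Rightarrow> 'w measure) \<Rightarrow> bool" where
  "filtration_on M Ft \<longleftrightarrow> (\<forall>t\<ge>0. subalgebra M (Ft t)) \<and>
     (\<forall>s t. 0 \<le> s \<and> s \<le> t \<longrightarrow> sets (Ft s) \<subseteq> sets (Ft t))"

definition brownian_motion :: "'w measure \<Rightarrow> (real \<Rightarrow> 'w \<Rightarrow> real) \<Rightarrow> bool" where
  "brownian_motion M b \<longleftrightarrow>
     (\<forall>t\<ge>0. b t \<in> borel_measurable M) \<and>
     (AE \<omega> in M. b 0 \<omega> = 0) \<and>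
     (AE \<omega> in M. continuous_on {0..} (\<lambda>t. b t \<omega>)) \<and>
     (\<forall>t. 0 \<le> t 0 \<longrightarrow> mono t \<longrightarrow>
        prob_space.indep_vars M (\<lambda>_. borel) (\<lambda>k \<omega>. b (t (Suc k)) \<omega> - b (t k) \<omega>) (UNIV :: nat set)) \<and>
     (\<forall>s t. 0 \<le> s \<and> s < t \<longrightarrow>
        distributed M lborel (\<lambda>\<omega>. b t \<omega> - b s \<omega>) (normal_density 0 (sqrt (t - s))))"

text \<open>
  The coordinate processes of a cylindrical $Q$-Wiener process
  $W^Q(t) = \sum_i \sqrt{q_i}\,\beta_i(t) e_i$ relative to a filtration: independent Brownian
  motions which are adapted and whose increments are jointly independent of the past.
  The series itself need not converge in the Hilbert space.
\<close>

definition wiener_coordinates ::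
  "'w measure \<Rightarrow> (real \<Rightarrow> 'w measure) \<Rightarrow> (nat \<Rightarrow> real \<Rightarrow> 'w \<Rightarrow> real) \<Rightarrow> bool" where
  "wiener_coordinates M Ft B \<longleftrightarrow>
     (\<forall>i. brownian_motion M (B i)) \<and>
     prob_space.indep_vars M (\<lambda>_. \<Pi>\<^sub>M t\<in>{0..}. borel) (\<lambda>i \<omega>. \<lambda>t\<in>{0..}. B i t \<omega>) UNIV \<and>
     (\<forall>i. \<forall>t\<ge>0. B i t \<in> borel_measurable (Ft t)) \<and>
     (\<forall>s t. 0 \<le> s \<and> s \<le> t \<longrightarrow>
        prob_space.indep_set M (sets (Ft s))
          {(\<lambda>\<omega> i. B i t \<omega> - B i s \<omega>) -` S \<inter> space M |S. S \<in> sets (\<Pi>\<^sub>M i\<in>UNIV. borel)})"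

text \<open>$P_n W^Q(t)$, which is well defined even when $W^Q(t)$ is only cylindrical.\<close>

definition galerkin_noise ::
  "(nat \<Rightarrow> 'a::real_inner) \<Rightarrow> (nat \<Rightarrow> real) \<Rightarrow> (nat \<Rightarrow> real \<Rightarrow> 'w \<Rightarrow> real) \<Rightarrow> nat \<Rightarrow> real \<Rightarrow> 'w \<Rightarrow> 'a"
where
  "galerkin_noise e q B n t \<omega> = (\<Sum>i<n. (sqrt (q i) * B i t \<omega>) *\<^sub>R e i)"

section \<open>The exponential Euler scheme\<close>

text \<open>
  The chain started at \<open>x\<close>. The stochastic integral over one step has a constant integrand,
  so it is \<open>galerkin_semigroup\<close> applied to the increment of \<open>galerkin_noise\<close>.
\<close>

primrec expo_euler ::
  "('a::real_inner \<Rightarrow> 'a) \<Rightarrow> (nat \<Rightarrow> 'a) \<Rightarrow> (nat \<Rightarrow> real) \<Rightarrow> (nat \<Rightarrow> real \<Rightarrow> 'w \<Rightarrow> real) \<Rightarrow>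
   ('a \<Rightarrow> 'a) \<Rightarrow> nat \<Rightarrow> real \<Rightarrow> 'a \<Rightarrow> nat \<Rightarrow> 'w \<Rightarrow> 'a" where
  "expo_euler A e q B F n \<tau> x 0 \<omega> = x"
| "expo_euler A e q B F n \<tau> x (Suc m) \<omega> =
     galerkin_semigroup A e n \<tau> (expo_euler A e q B F n \<tau> x m \<omega>) +
     \<tau> *\<^sub>R galerkin_semigroup A e n \<tau> (galerkin_proj e n (F (expo_euler A e q B F n \<tau> x m \<omega>))) +
     galerkin_semigroup A e n \<tau>
       (galerkin_noise e q B n (real (Suc m) * \<tau>) \<omega> - galerkin_noise e q B n (real m * \<tau>) \<omega>)"

section \<open>Markov chains, invariant measures, ergodicity\<close>

text \<open>
  \<open>Z x m\<close> is the chain at step \<open>m\<close> when started at \<open>x\<close>, so this is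
  $P\Phi(x) = E[\Phi(Y_1) \mid Y_0 = x]$. For unbounded \<open>\<Phi>\<close> the junk value 0 at points \<open>x\<close> where the
  expectation does not exist concerns only a null set of any invariant measure for which
  \<open>\<Phi>\<close> is integrable.
\<close>

definition transition_op ::
  "'w measure \<Rightarrow> ('a \<Rightarrow> nat \<Rightarrow> 'w \<Rightarrow> 'a) \<Rightarrow> ('a \<Rightarrow> real) \<Rightarrow> 'a \<Rightarrow> real" where
  "transition_op M Z \<Phi> x = (\<integral>\<omega>. \<Phi> (Z x 1 \<omega>) \<partial>M)"

definition bounded_borel :: "'a::topological_space set \<Rightarrow> ('a \<Rightarrow> real) set" where
  "bounded_borel S = {\<Phi> \<in> borel_measurable (restrict_space borel S). bounded (\<Phi> ` S)}"

definition markov_chain_on ::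
  "'w measure \<Rightarrow> (nat \<Rightarrow> 'w measure) \<Rightarrow> 'a::topological_space set \<Rightarrow>
   (('a \<Rightarrow> real) \<Rightarrow> 'a \<Rightarrow> real) \<Rightarrow> (nat \<Rightarrow> 'w \<Rightarrow> 'a) \<Rightarrow> bool" where
  "markov_chain_on M G S P Y \<longleftrightarrow>
     (\<forall>m. Y m \<in> measurable (G m) (restrict_space borel S)) \<and>
     (\<forall>m. \<forall>\<Phi>\<in>bounded_borel S.
        AE \<omega> in M. real_cond_exp M (G m) (\<lambda>\<omega>. \<Phi> (Y (Suc m) \<omega>)) \<omega> = P \<Phi> (Y m \<omega>))"

definition invariant_prob ::
  "'a::topological_space set \<Rightarrow> (('a \<Rightarrow> real) \<Rightarrow> 'a \<Rightarrow> real) \<Rightarrow> 'a measure \<Rightarrow> bool" where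
  "invariant_prob S P \<mu> \<longleftrightarrow> prob_space \<mu> \<and> sets \<mu> = sets (restrict_space borel S) \<and>
     (\<forall>\<Phi>\<in>bounded_borel S. (\<integral>x. P \<Phi> x \<partial>\<mu>) = (\<integral>x. \<Phi> x \<partial>\<mu>))"

definition square_integrable :: "'a measure \<Rightarrow> ('a \<Rightarrow> real) set" where
  "square_integrable \<mu> = {\<Phi> \<in> borel_measurable \<mu>. integrable \<mu> (\<lambda>x. (\<Phi> x)\<^sup>2)}"

text \<open>
  Convergence of the time averages in $L^2(\mu)$; the squared distance is a nonnegative
  (extended) integral, so no integrability default can make it vanish.
\<close>

definition ergodic_wrt :: "(('a \<Rightarrow> real) \<Rightarrow> 'a \<Rightarrow> real) \<Rightarrow> 'a measure \<Rightarrow> bool" where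
  "ergodic_wrt P \<mu> \<longleftrightarrow> (\<forall>\<Phi>\<in>square_integrable \<mu>.
     (\<forall>m. (P ^^ m) \<Phi> \<in> square_integrable \<mu>) \<and>
     (\<lambda>N. \<integral>\<^sup>+ x. ennreal (((1 / real N) * (\<Sum>m<N. (P ^^ m) \<Phi> x) - (\<integral>y. \<Phi> y \<partial>\<mu>))\<^sup>2) \<partial>\<mu>)
       \<longlonglongrightarrow> 0)"

end

theory Submission
  imports Defs
begin

text \<open>
  One step of the scheme has the form $Y_{m+1} = f(Y_m) + g_m$ on $H_n$, where
  $f(x) = E_n(\tau)(x + \tau P_n F(x))$ and the $g_m$ are independent and identically distributed
  Gaussian vectors. For $d = x - y$ the one-sided condition and the Lipschitz bound give
  $\|d + \tau (F(x) - F(y))\|^2 \le (1 + 2 \tau L_F + \tau^2 L^2) \|d\|^2$, and $E_n(\tau)$ contributes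
  the factor $e^{-2 \lambda_1 \tau}$. So $f$ is Lipschitz with constant
  $\kappa = \exp(\tau L_F + \tau^2 L^2 / 2 - \lambda_1 \tau)$
  (\<open>expo_euler_drift_lipschitz\<close>), and the step size restriction makes $\kappa < 1$. The rest
  concerns arbitrary chains given by a contraction with additive noise whose norm is integrable.

  \<^item> Two copies of the chain driven by the same noise approach each other at rate $\kappa^m$. Hence
    the transition operator $P$ lowers Lipschitz constants by the factor $\kappa$
    (\<open>kernel_op_lipschitz\<close>), and $P^m \Phi \to \int \Phi \, d\nu$ pointwise for every bounded Lipschitz
    $\Phi$ and every invariant $\nu$ (\<open>kernel_op_funpow_tendsto\<close>). As bounded Lipschitz functions
    determine a measure, there is at most one invariant measure (\<open>invariant_unique\<close>).

  \<^item> $P$ is a contraction on $L^2(\nu)$, and bounded Lipschitz functions are dense there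
    (\<open>bounded_lipschitz_dense_L2\<close>). So $P^m \Phi \to \int \Phi \, d\nu$ in $L^2(\nu)$ for all
    $\Phi \in L^2(\nu)$ (\<open>kernel_op_funpow_mixing\<close>). This is stronger than the convergence of the
    time averages, which is ergodicity (\<open>invariant_ergodic\<close>).

  \<^item> An invariant measure is obtained by running the recursion from the remote past: with
    independent copies $\omega_0, \omega_1, \dots$ of the noise, the backward iterates
    $X_m = F_{\omega_0} \circ \dots \circ F_{\omega_{m-1}}(0)$, where $F_\omega(x) = f(x) + g(\omega)$,
    have increments of size at most $\kappa^m \|f(0) + g(\omega_m)\|$ and therefore converge almost
    surely. Prepending one more copy of the noise to the sequence applies one step of the chain to
    the limit and preserves the law of the sequence, so the law of the limit is invariant
    (\<open>invariant_stationary\<close>).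

  The Markov property (\<open>real_cond_exp_step\<close>) is the usual freezing argument: the increment of the
  noise is independent of the past, so it may be integrated out with the present state held fixed.
\<close>

section \<open>The squared mean distance of two functions\<close>

text \<open>
  The squared $L^2(\nu)$ distance. It takes values in the extended nonnegative reals, so that it can
  be manipulated before any integrability is known.
\<close>

definition sqdist :: "'a measure \<Rightarrow> ('a \<Rightarrow> real) \<Rightarrow> ('a \<Rightarrow> real) \<Rightarrow> ennreal" where
  "sqdist \<nu> \<Phi> \<Psi> = (\<integral>\<^sup>+x. ennreal ((\<Phi> x - \<Psi> x)\<^sup>2) \<partial>\<nu>)"

lemma sqdist_commute: "sqdist \<nu> \<Phi> \<Psi> = sqdist \<nu> \<Psi> \<Phi>"
  by (simp add: sqdist_def power2_commute)

text \<open>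
  The triangle inequality of the norm turns into $(a + b)^2 \le 2 a^2 + 2 b^2$ for squared distances.
\<close>

lemma sqdist_triangle:
  assumes [measurable]: "\<Phi> \<in> borel_measurable \<nu>" "\<Psi> \<in> borel_measurable \<nu>" "\<Xi> \<in> borel_measurable \<nu>"
  shows "sqdist \<nu> \<Phi> \<Xi> \<le> 2 * sqdist \<nu> \<Phi> \<Psi> + 2 * sqdist \<nu> \<Psi> \<Xi>"
proof -
  have "ennreal ((\<Phi> x - \<Xi> x)\<^sup>2) \<le> 2 * ennreal ((\<Phi> x - \<Psi> x)\<^sup>2) + 2 * ennreal ((\<Psi> x - \<Xi> x)\<^sup>2)" for x
  proof -
    have "(\<Phi> x - \<Xi> x)\<^sup>2 \<le> 2 * (\<Phi> x - \<Psi> x)\<^sup>2 + 2 * (\<Psi> x - \<Xi> x)\<^sup>2"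
      using zero_le_power2[of "(\<Phi> x - \<Psi> x) - (\<Psi> x - \<Xi> x)"]
      by (simp add: power2_eq_square algebra_simps)
    then have "ennreal ((\<Phi> x - \<Xi> x)\<^sup>2) \<le> ennreal (2 * (\<Phi> x - \<Psi> x)\<^sup>2 + 2 * (\<Psi> x - \<Xi> x)\<^sup>2)"
      by (rule ennreal_leI)
    then show ?thesis by (simp add: ennreal_plus ennreal_mult)
  qed
  then have "sqdist \<nu> \<Phi> \<Xi> \<le> (\<integral>\<^sup>+x. 2 * ennreal ((\<Phi> x - \<Psi> x)\<^sup>2) + 2 * ennreal ((\<Psi> x - \<Xi> x)\<^sup>2) \<partial>\<nu>)"
    unfolding sqdist_def by (intro nn_integral_mono)
  also have "\<dots> = 2 * sqdist \<nu> \<Phi> \<Psi> + 2 * sqdist \<nu> \<Psi> \<Xi>"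
    unfolding sqdist_def by (subst nn_integral_add) (auto simp: nn_integral_cmult)
  finally show ?thesis .
qed

text \<open>
  For an $\epsilon$-argument: squared distances lose a factor 4 when two equal bounds are added.
\<close>

lemma sqdist_triangle_quarters:
  assumes "\<Phi> \<in> borel_measurable \<nu>" "\<Psi> \<in> borel_measurable \<nu>" "\<Xi> \<in> borel_measurable \<nu>"
    and "sqdist \<nu> \<Phi> \<Psi> \<le> ennreal (\<epsilon> / 4)" "sqdist \<nu> \<Psi> \<Xi> \<le> ennreal (\<epsilon> / 4)" "0 < \<epsilon>"
  shows "sqdist \<nu> \<Phi> \<Xi> \<le> ennreal \<epsilon>"
proof -
  have "sqdist \<nu> \<Phi> \<Xi> \<le> 2 * ennreal (\<epsilon> / 4) + 2 * ennreal (\<epsilon> / 4)"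
    by (rule order_trans[OF sqdist_triangle[OF assms(1-3)]]) (intro add_mono mult_left_mono assms; simp)
  also have "2 * ennreal (\<epsilon> / 4) = ennreal (2 * (\<epsilon> / 4))"
    using \<open>0 < \<epsilon>\<close> by (subst ennreal_mult) auto
  also have "ennreal (2 * (\<epsilon> / 4)) + ennreal (2 * (\<epsilon> / 4)) = ennreal \<epsilon>"
    using \<open>0 < \<epsilon>\<close> by (subst ennreal_plus[symmetric]) auto
  finally show ?thesis .
qed

lemma sqdist_dominated_convergence:
  assumes [measurable]: "\<And>k. \<Phi> k \<in> borel_measurable \<nu>" "\<Psi> \<in> borel_measurable \<nu>"
    and lim: "\<And>x. x \<in> space \<nu> \<Longrightarrow> (\<lambda>k. \<Phi> k x) \<longlonglongrightarrow> \<Psi> x"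
    and bound: "\<And>k x. x \<in> space \<nu> \<Longrightarrow> (\<Phi> k x - \<Psi> x)\<^sup>2 \<le> w x" and w: "integrable \<nu> w"
  shows "(\<lambda>k. sqdist \<nu> (\<Phi> k) \<Psi>) \<longlonglongrightarrow> 0"
proof -
  note borel_measurable_integrable[OF w, measurable]
  have "(\<lambda>k. \<integral>\<^sup>+x. ennreal ((\<Phi> k x - \<Psi> x)\<^sup>2) \<partial>\<nu>) \<longlonglongrightarrow> (\<integral>\<^sup>+x. 0 \<partial>\<nu>)"
  proof (rule nn_integral_dominated_convergence[where w = "\<lambda>x. ennreal (w x)"])
    have "0 \<le> w x" if "x \<in> space \<nu>" for x
      using bound[OF that, of 0] zero_le_power2 order_trans by blast
    then show "(\<integral>\<^sup>+x. ennreal (w x) \<partial>\<nu>) < \<infinity>"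
      using w by (subst nn_integral_eq_integral) (auto intro!: AE_I2)
    show "AE x in \<nu>. (\<lambda>k. ennreal ((\<Phi> k x - \<Psi> x)\<^sup>2)) \<longlonglongrightarrow> 0"
    proof (rule AE_I2)
      fix x assume "x \<in> space \<nu>"
      from lim[OF this] have "(\<lambda>k. (\<Phi> k x - \<Psi> x)\<^sup>2) \<longlonglongrightarrow> (\<Psi> x - \<Psi> x)\<^sup>2"
        by (intro tendsto_intros)
      then have "(\<lambda>k. ennreal ((\<Phi> k x - \<Psi> x)\<^sup>2)) \<longlonglongrightarrow> ennreal ((\<Psi> x - \<Psi> x)\<^sup>2)"
        by (rule tendsto_ennrealI)
      then show "(\<lambda>k. ennreal ((\<Phi> k x - \<Psi> x)\<^sup>2)) \<longlonglongrightarrow> 0" by simp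
    qed
  qed (auto intro!: AE_I2 ennreal_leI bound)
  then show ?thesis by (simp add: sqdist_def)
qed

lemma ennreal_LIMSEQ_0_E:
  assumes "a \<longlonglongrightarrow> (0::ennreal)" "0 < (\<epsilon>::real)"
  obtains k where "a k \<le> ennreal \<epsilon>"
proof -
  have "eventually (\<lambda>k. a k < ennreal \<epsilon>) sequentially"
    using assms by (intro order_tendstoD(2)[OF assms(1)]) simp
  then show thesis by (metis eventually_sequentially less_imp_le order_refl that)
qed

section \<open>Bounded Lipschitz functions\<close>

definition bounded_lipschitz :: "'a::metric_space set \<Rightarrow> ('a \<Rightarrow> real) set" where
  "bounded_lipschitz S = {\<Phi>. \<exists>b C. C-lipschitz_on S \<Phi> \<and> (\<forall>x\<in>S. \<bar>\<Phi> x\<bar> \<le> b)}"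

lemma bounded_lipschitz_add:
  assumes "\<Phi> \<in> bounded_lipschitz S" "\<Psi> \<in> bounded_lipschitz S"
  shows "(\<lambda>x. \<Phi> x + \<Psi> x) \<in> bounded_lipschitz S"
proof -
  obtain b C b' C' where *: "C-lipschitz_on S \<Phi>" "\<And>x. x \<in> S \<Longrightarrow> \<bar>\<Phi> x\<bar> \<le> b"
    "C'-lipschitz_on S \<Psi>" "\<And>x. x \<in> S \<Longrightarrow> \<bar>\<Psi> x\<bar> \<le> b'"
    using assms unfolding bounded_lipschitz_def by blast
  have "\<forall>x\<in>S. \<bar>\<Phi> x + \<Psi> x\<bar> \<le> b + b'"
    using *(2,4) by (smt (verit))
  with lipschitz_on_add[OF *(1,3)] show ?thesis
    unfolding bounded_lipschitz_def by blast
qed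

lemma bounded_lipschitz_cmult:
  assumes "\<Phi> \<in> bounded_lipschitz S"
  shows "(\<lambda>x. c * \<Phi> x) \<in> bounded_lipschitz S"
proof -
  obtain b C where *: "C-lipschitz_on S \<Phi>" "\<And>x. x \<in> S \<Longrightarrow> \<bar>\<Phi> x\<bar> \<le> b"
    using assms by (auto simp: bounded_lipschitz_def)
  have "\<forall>x\<in>S. \<bar>c * \<Phi> x\<bar> \<le> \<bar>c\<bar> * b"
    using *(2) by (simp add: abs_mult mult_left_mono)
  with lipschitz_on_cmult_real[OF *(1)] show ?thesis
    unfolding bounded_lipschitz_def by blast
qed

lemma bounded_lipschitz_const: "(\<lambda>x. c) \<in> bounded_lipschitz S"
  using lipschitz_on_constant[of S c] unfolding bounded_lipschitz_def by blast

lemma bounded_lipschitz_bounded_borel: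
  assumes "\<Phi> \<in> bounded_lipschitz S"
  shows "\<Phi> \<in> bounded_borel S"
proof -
  obtain b C where *: "C-lipschitz_on S \<Phi>" "\<And>x. x \<in> S \<Longrightarrow> \<bar>\<Phi> x\<bar> \<le> b"
    using assms by (auto simp: bounded_lipschitz_def)
  from *(1) have "continuous_on S \<Phi>" by (rule lipschitz_on_continuous_on)
  then have "\<Phi> \<in> borel_measurable (restrict_space borel S)"
    by (rule borel_measurable_continuous_on_restrict)
  with *(2) show ?thesis by (auto simp: bounded_borel_def bounded_iff)
qed

text \<open>
  Lipschitz functions that decrease to the indicator of a nonempty closed set. The condition
  $C \neq \emptyset$ matters because the distance to the empty set is 0 by convention.
\<close>

definition closed_cutoff :: "'a::metric_space set \<Rightarrow> nat \<Rightarrow> 'a \<Rightarrow> real" where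
  "closed_cutoff C k x = max 0 (1 - real k * infdist x C)"

lemma closed_cutoff_bounds: "0 \<le> closed_cutoff C k x" "closed_cutoff C k x \<le> 1"
  by (auto simp: closed_cutoff_def infdist_nonneg)

lemma closed_cutoff_bounded_lipschitz: "closed_cutoff C k \<in> bounded_lipschitz S"
proof -
  have "(real k)-lipschitz_on S (closed_cutoff C k)"
  proof (rule lipschitz_onI)
    fix x y
    have "\<bar>closed_cutoff C k x - closed_cutoff C k y\<bar> \<le> \<bar>real k * infdist x C - real k * infdist y C\<bar>"
      by (auto simp: closed_cutoff_def)
    also have "\<dots> = real k * \<bar>infdist x C - infdist y C\<bar>"
      by (simp add: abs_mult flip: right_diff_distrib)
    also have "\<dots> \<le> real k * dist x y"
      by (intro mult_left_mono infdist_triangle_abs) simp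
    finally show "dist (closed_cutoff C k x) (closed_cutoff C k y) \<le> real k * dist x y"
      by (simp add: dist_real_def)
  qed simp
  moreover have "\<forall>x\<in>S. \<bar>closed_cutoff C k x\<bar> \<le> 1"
    using closed_cutoff_bounds[of C k] by (simp add: abs_of_nonneg)
  ultimately show ?thesis unfolding bounded_lipschitz_def by blast
qed

lemma closed_cutoff_tendsto:
  assumes "closed C" "C \<noteq> {}"
  shows "(\<lambda>k. closed_cutoff C k x) \<longlonglongrightarrow> indicator C x"
proof (cases "x \<in> C")
  case True
  then show ?thesis by (simp add: closed_cutoff_def)
next
  case False
  with assms have pos: "0 < infdist x C"
    by (meson infdist_pos_not_in_closed)
  obtain K :: nat where K: "1 / infdist x C < K" using reals_Archimedean2 by blast
  have "closed_cutoff C k x = 0" if "K \<le> k" for k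
  proof -
    have "1 \<le> real K * infdist x C" using K pos by (simp add: field_simps)
    also have "\<dots> \<le> real k * infdist x C" using that pos by simp
    finally show ?thesis by (simp add: closed_cutoff_def)
  qed
  then have "eventually (\<lambda>k. closed_cutoff C k x = indicator C x) sequentially"
    using False by (auto simp: eventually_sequentially)
  then show ?thesis by (rule tendsto_eventually)
qed

section \<open>Bounded Lipschitz functions determine a probability measure\<close>

lemma sets_restrict_borel_eq_sigma_closed:
  "sets (restrict_space borel S) = sigma_sets S ((\<inter>) S ` Collect closed)"
proof -
  have "sets (restrict_space borel S) = {(\<lambda>x. x) -` A \<inter> S |A. A \<in> sigma_sets UNIV (Collect closed)}"
    by (subst borel_eq_closed) (auto simp: sets_restrict_space)
  also have "\<dots> = sigma_sets S {(\<lambda>x. x) -` A \<inter> S |A. A \<in> Collect closed}"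
    by (rule sigma_sets_vimage_commute) simp
  also have "{(\<lambda>x. x) -` A \<inter> S |A. A \<in> Collect closed} = (\<inter>) S ` Collect closed"
    by auto
  finally show ?thesis .
qed

lemma Int_stable_closed_traces: "Int_stable ((\<inter>) S ` Collect closed)"
proof (rule Int_stableI)
  fix a b assume "a \<in> (\<inter>) S ` Collect closed" "b \<in> (\<inter>) S ` Collect closed"
  then obtain C C' where "closed C" "a = S \<inter> C" "closed C'" "b = S \<inter> C'" by auto
  then have "closed (C \<inter> C')" "a \<inter> b = S \<inter> (C \<inter> C')" by auto
  then show "a \<inter> b \<in> (\<inter>) S ` Collect closed" by blast
qed

text \<open>
  The cutoffs recover the measure of every closed set, and the closed sets form an intersection
  stable generator of the Borel sets.
\<close>

lemma prob_eqI_bounded_lipschitz: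
  fixes S :: "'a::metric_space set"
  assumes \<mu>: "prob_space \<mu>" "sets \<mu> = sets (restrict_space borel S)"
    and \<nu>: "prob_space \<nu>" "sets \<nu> = sets (restrict_space borel S)"
    and eq: "\<And>\<Phi>. \<Phi> \<in> bounded_lipschitz S \<Longrightarrow> (\<integral>x. \<Phi> x \<partial>\<mu>) = (\<integral>x. \<Phi> x \<partial>\<nu>)"
  shows "\<mu> = \<nu>"
proof (rule measure_eqI_generator_eq[OF Int_stable_closed_traces])
  interpret \<mu>: prob_space \<mu> by fact
  interpret \<nu>: prob_space \<nu> by fact
  have space: "space \<mu> = S" "space \<nu> = S"
    using sets_eq_imp_space_eq[OF \<mu>(2)] sets_eq_imp_space_eq[OF \<nu>(2)] by (simp_all add: space_restrict_space)
  have lim: "(\<lambda>k. \<integral>x. closed_cutoff C k x \<partial>\<rho>) \<longlonglongrightarrow> measure \<rho> (S \<inter> C)"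
    if \<rho>: "prob_space \<rho>" "sets \<rho> = sets (restrict_space borel S)" and C: "closed C" "C \<noteq> {}" for \<rho> C
  proof -
    interpret \<rho>: prob_space \<rho> by fact
    have sp: "space \<rho> = S"
      using sets_eq_imp_space_eq[OF \<rho>(2)] by (simp add: space_restrict_space)
    have SC: "S \<inter> C \<in> sets \<rho>"
      using C by (auto simp: \<rho>(2) sets_restrict_space)
    have "(\<lambda>k. \<integral>x. closed_cutoff C k x \<partial>\<rho>) \<longlonglongrightarrow> (\<integral>x. indicator (S \<inter> C) x \<partial>\<rho>)"
    proof (rule integral_dominated_convergence[where w = "\<lambda>_. 1"])
      show "closed_cutoff C k \<in> borel_measurable \<rho>" for k
        using bounded_lipschitz_bounded_borel[OF closed_cutoff_bounded_lipschitz[of C k S]]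
        by (simp add: bounded_borel_def measurable_cong_sets[OF \<rho>(2) refl])
      show "AE x in \<rho>. (\<lambda>k. closed_cutoff C k x) \<longlonglongrightarrow> indicator (S \<inter> C) x"
        using closed_cutoff_tendsto[OF C] by (intro AE_I2) (auto simp: sp indicator_inter_arith)
      show "AE x in \<rho>. norm (closed_cutoff C k x) \<le> 1" for k
        using closed_cutoff_bounds[of C k] by simp
    qed (use SC in auto)
    then show ?thesis using SC by simp
  qed
  fix X assume "X \<in> (\<inter>) S ` Collect closed"
  then obtain C where C: "closed C" "X = S \<inter> C" by auto
  show "emeasure \<mu> X = emeasure \<nu> X"
  proof (cases "C = {}")
    case False
    have "measure \<mu> X = measure \<nu> X"
      using lim[OF \<mu> C(1) False] lim[OF \<nu> C(1) False]
      unfolding eq[OF closed_cutoff_bounded_lipschitz] C(2) by (rule LIMSEQ_unique)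
    then show ?thesis by (simp add: \<mu>.emeasure_eq_measure \<nu>.emeasure_eq_measure)
  qed (simp add: C)
next
  show "emeasure \<mu> S \<noteq> \<infinity>"
    using finite_measure.emeasure_finite[OF prob_space.finite_measure[OF \<mu>(1)]] by simp
  show "range (\<lambda>_::nat. S) \<subseteq> (\<inter>) S ` Collect closed" by (auto intro!: image_eqI[of _ _ UNIV])
qed (auto simp: \<mu> \<nu> sets_restrict_borel_eq_sigma_closed)

section \<open>Density of the bounded Lipschitz functions\<close>

text \<open>
  The $L^2(\nu)$ closure of the bounded Lipschitz functions. It is a vector space closed under
  dominated limits, which makes it possible to enlarge it step by step until it is all of $L^2(\nu)$.
\<close>

definition L2_closure :: "'a measure \<Rightarrow> 'a::metric_space set \<Rightarrow> ('a \<Rightarrow> real) set" where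
  "L2_closure \<nu> S = {\<Phi> \<in> borel_measurable \<nu>.
     \<forall>\<epsilon>>0. \<exists>\<Psi>\<in>bounded_lipschitz S. sqdist \<nu> \<Phi> \<Psi> \<le> ennreal \<epsilon>}"

context
  fixes \<nu> :: "'a::metric_space measure" and S :: "'a set"
  assumes fin: "finite_measure \<nu>" and sets_\<nu>: "sets \<nu> = sets (restrict_space borel S)"
begin

interpretation finite_measure \<nu> by (rule fin)

lemma bounded_lipschitz_measurable:
  assumes "\<Psi> \<in> bounded_lipschitz S"
  shows "\<Psi> \<in> borel_measurable \<nu>"
  using bounded_lipschitz_bounded_borel[OF assms]
  by (simp add: bounded_borel_def measurable_cong_sets[OF sets_\<nu> refl])

lemma L2_closure_closed:
  assumes \<Phi>: "\<Phi> \<in> borel_measurable \<nu>"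
    and near: "\<And>\<epsilon>. 0 < \<epsilon> \<Longrightarrow> \<exists>\<Psi>\<in>L2_closure \<nu> S. sqdist \<nu> \<Phi> \<Psi> \<le> ennreal \<epsilon>"
  shows "\<Phi> \<in> L2_closure \<nu> S"
  unfolding L2_closure_def
proof (intro CollectI conjI allI impI \<Phi>)
  fix \<epsilon> :: real assume "0 < \<epsilon>"
  then obtain \<Psi> where \<Psi>: "\<Psi> \<in> L2_closure \<nu> S" "sqdist \<nu> \<Phi> \<Psi> \<le> ennreal (\<epsilon> / 4)"
    using near[of "\<epsilon> / 4"] by auto
  then obtain \<Xi> where \<Xi>: "\<Xi> \<in> bounded_lipschitz S" "sqdist \<nu> \<Psi> \<Xi> \<le> ennreal (\<epsilon> / 4)"
    using \<open>0 < \<epsilon>\<close> unfolding L2_closure_def by (smt (verit, best) divide_pos_pos mem_Collect_eq)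
  have "sqdist \<nu> \<Phi> \<Xi> \<le> ennreal \<epsilon>"
    using \<Phi> \<Psi> \<Xi> \<open>0 < \<epsilon>\<close>
    by (intro sqdist_triangle_quarters[of \<Phi> \<nu> \<Psi> \<Xi>])
      (auto simp: L2_closure_def intro: bounded_lipschitz_measurable)
  with \<Xi> show "\<exists>\<Psi>\<in>bounded_lipschitz S. sqdist \<nu> \<Phi> \<Psi> \<le> ennreal \<epsilon>" by blast
qed

lemma bounded_lipschitz_L2_closure:
  assumes "\<Phi> \<in> bounded_lipschitz S"
  shows "\<Phi> \<in> L2_closure \<nu> S"
proof -
  have "sqdist \<nu> \<Phi> \<Phi> \<le> ennreal \<epsilon>" for \<epsilon> by (simp add: sqdist_def)
  then show ?thesis
    using assms bounded_lipschitz_measurable[OF assms] by (auto simp: L2_closure_def)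
qed

lemma L2_closure_dominated_limit:
  assumes "\<And>k. \<Phi> k \<in> L2_closure \<nu> S" "\<Psi> \<in> borel_measurable \<nu>"
    and "\<And>x. x \<in> space \<nu> \<Longrightarrow> (\<lambda>k. \<Phi> k x) \<longlonglongrightarrow> \<Psi> x"
    and "\<And>k x. x \<in> space \<nu> \<Longrightarrow> (\<Phi> k x - \<Psi> x)\<^sup>2 \<le> w x" "integrable \<nu> w"
  shows "\<Psi> \<in> L2_closure \<nu> S"
proof (rule L2_closure_closed[OF assms(2)])
  have "(\<lambda>k. sqdist \<nu> (\<Phi> k) \<Psi>) \<longlonglongrightarrow> 0"
    using assms by (intro sqdist_dominated_convergence[where w = w]) (auto simp: L2_closure_def)
  fix \<epsilon> :: real assume "0 < \<epsilon>"
  with \<open>(\<lambda>k. sqdist \<nu> (\<Phi> k) \<Psi>) \<longlonglongrightarrow> 0\<close> obtain k where "sqdist \<nu> (\<Phi> k) \<Psi> \<le> ennreal \<epsilon>"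
    by (rule ennreal_LIMSEQ_0_E)
  with assms(1) show "\<exists>\<Xi>\<in>L2_closure \<nu> S. sqdist \<nu> \<Psi> \<Xi> \<le> ennreal \<epsilon>"
    by (auto simp: sqdist_commute)
qed

lemma L2_closure_add:
  assumes \<Phi>: "\<Phi> \<in> L2_closure \<nu> S" and \<Psi>: "\<Psi> \<in> L2_closure \<nu> S"
  shows "(\<lambda>x. \<Phi> x + \<Psi> x) \<in> L2_closure \<nu> S"
  unfolding L2_closure_def
proof (intro CollectI conjI allI impI)
  have [measurable]: "\<Phi> \<in> borel_measurable \<nu>" "\<Psi> \<in> borel_measurable \<nu>"
    using \<Phi> \<Psi> by (auto simp: L2_closure_def)
  show "(\<lambda>x. \<Phi> x + \<Psi> x) \<in> borel_measurable \<nu>" by measurable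
  fix \<epsilon> :: real assume "0 < \<epsilon>"
  then have "0 < \<epsilon> / 4" by simp
  with \<Phi> \<Psi> obtain \<Phi>' \<Psi>' where *: "\<Phi>' \<in> bounded_lipschitz S" "sqdist \<nu> \<Phi> \<Phi>' \<le> ennreal (\<epsilon> / 4)"
    "\<Psi>' \<in> bounded_lipschitz S" "sqdist \<nu> \<Psi> \<Psi>' \<le> ennreal (\<epsilon> / 4)"
    unfolding L2_closure_def by blast
  note [measurable] = *(1,3)[THEN bounded_lipschitz_measurable]
  have "sqdist \<nu> (\<lambda>x. \<Phi> x + \<Psi> x) (\<lambda>x. \<Phi>' x + \<Psi>' x) \<le> ennreal \<epsilon>"
    by (rule sqdist_triangle_quarters[where \<Psi> = "\<lambda>x. \<Phi>' x + \<Psi> x"])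
      (use * \<open>0 < \<epsilon>\<close> in \<open>auto simp: sqdist_def\<close>)
  then show "\<exists>\<Xi>\<in>bounded_lipschitz S. sqdist \<nu> (\<lambda>x. \<Phi> x + \<Psi> x) \<Xi> \<le> ennreal \<epsilon>"
    using bounded_lipschitz_add[OF *(1,3)] by blast
qed

lemma L2_closure_cmult:
  assumes \<Phi>: "\<Phi> \<in> L2_closure \<nu> S"
  shows "(\<lambda>x. c * \<Phi> x) \<in> L2_closure \<nu> S"
  unfolding L2_closure_def
proof (intro CollectI conjI allI impI)
  have [measurable]: "\<Phi> \<in> borel_measurable \<nu>"
    using \<Phi> by (auto simp: L2_closure_def)
  show "(\<lambda>x. c * \<Phi> x) \<in> borel_measurable \<nu>" by measurable
  fix \<epsilon> :: real assume "0 < \<epsilon>"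
  then have "0 < \<epsilon> / (c\<^sup>2 + 1)" by (simp add: add_nonneg_pos)
  with \<Phi> obtain \<Psi> where \<Psi>: "\<Psi> \<in> bounded_lipschitz S" "sqdist \<nu> \<Phi> \<Psi> \<le> ennreal (\<epsilon> / (c\<^sup>2 + 1))"
    unfolding L2_closure_def by blast
  note [measurable] = bounded_lipschitz_measurable[OF \<Psi>(1)]
  have "sqdist \<nu> (\<lambda>x. c * \<Phi> x) (\<lambda>x. c * \<Psi> x) = ennreal (c\<^sup>2) * sqdist \<nu> \<Phi> \<Psi>"
    unfolding sqdist_def
    by (subst nn_integral_cmult[symmetric])
      (auto simp: power_mult_distrib ennreal_mult simp flip: right_diff_distrib)
  also have "\<dots> \<le> ennreal (c\<^sup>2) * ennreal (\<epsilon> / (c\<^sup>2 + 1))"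
    by (intro mult_left_mono \<Psi>) simp
  also have "\<dots> = ennreal (c\<^sup>2 * (\<epsilon> / (c\<^sup>2 + 1)))"
    using \<open>0 < \<epsilon>\<close> by (intro ennreal_mult[symmetric] divide_nonneg_nonneg add_nonneg_nonneg zero_le_power2) simp_all
  also have "\<dots> \<le> ennreal \<epsilon>"
    using \<open>0 < \<epsilon>\<close> by (intro ennreal_leI) (simp add: pos_divide_le_eq add_pos_nonneg algebra_simps)
  finally show "\<exists>\<Xi>\<in>bounded_lipschitz S. sqdist \<nu> (\<lambda>x. c * \<Phi> x) \<Xi> \<le> ennreal \<epsilon>"
    using bounded_lipschitz_cmult[OF \<Psi>(1)] by blast
qed

lemma L2_closure_sum:
  assumes "finite I" "\<And>i. i \<in> I \<Longrightarrow> \<Phi> i \<in> L2_closure \<nu> S"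
  shows "(\<lambda>x. \<Sum>i\<in>I. \<Phi> i x) \<in> L2_closure \<nu> S"
  using assms
  by (induction rule: finite_induct)
    (auto intro: L2_closure_add bounded_lipschitz_L2_closure[OF bounded_lipschitz_const])

lemma L2_closure_cong:
  assumes "\<Phi> \<in> L2_closure \<nu> S" "\<And>x. x \<in> space \<nu> \<Longrightarrow> \<Phi> x = \<Psi> x"
  shows "\<Psi> \<in> L2_closure \<nu> S"
proof -
  have "\<Psi> \<in> borel_measurable \<nu>"
    using assms measurable_cong[of \<nu> \<Phi> \<Psi> borel] by (simp add: L2_closure_def)
  then show ?thesis
    by (rule L2_closure_dominated_limit[where \<Phi> = "\<lambda>_. \<Phi>" and w = "\<lambda>_. 0", OF assms(1)])
      (simp_all add: assms(2))
qed

text \<open>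
  Closed sets are covered by the cutoffs; complements and countable disjoint unions follow from the
  closure properties, so Dynkin's theorem gives all Borel sets.
\<close>

lemma L2_closure_indicator:
  assumes "A \<in> sets \<nu>"
  shows "(indicator A :: 'a \<Rightarrow> real) \<in> L2_closure \<nu> S"
proof -
  have sp: "space \<nu> = S"
    using sets_eq_imp_space_eq[OF sets_\<nu>] by (simp add: space_restrict_space)
  have A: "A \<in> sigma_sets S ((\<inter>) S ` Collect closed)"
    using assms by (simp add: sets_\<nu> sets_restrict_borel_eq_sigma_closed)
  have sub: "(\<inter>) S ` Collect closed \<subseteq> Pow S" by auto
  from Int_stable_closed_traces[of S] sub A show ?thesis
  proof (induction rule: sigma_sets_induct_disjoint)
    case (basic A)
    then obtain C where C: "closed C" "A = S \<inter> C" by auto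
    show ?case
    proof (cases "C = {}")
      case True
      then show ?thesis
        using bounded_lipschitz_L2_closure[OF bounded_lipschitz_const[of 0]] C by simp
    next
      case False
      have A: "A \<in> sets \<nu>" using C by (auto simp: sets_\<nu> sets_restrict_space)
      show ?thesis
      proof (rule L2_closure_dominated_limit[where \<Phi> = "closed_cutoff C" and w = "\<lambda>_. 1"])
        show "(\<lambda>k. closed_cutoff C k x) \<longlonglongrightarrow> indicat_real A x" if "x \<in> space \<nu>" for x
          using closed_cutoff_tendsto[OF C(1) False, of x] that C(2)
          by (simp add: sp indicator_def)
        show "(closed_cutoff C k x - indicat_real A x)\<^sup>2 \<le> 1" for k x
          using closed_cutoff_bounds[of C k x] by (simp add: abs_square_le_1 indicator_def)
        show "closed_cutoff C k \<in> L2_closure \<nu> S" for k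
          by (intro bounded_lipschitz_L2_closure closed_cutoff_bounded_lipschitz)
      qed (use A in simp_all)
    qed
  next
    case empty
    then show ?case
      using bounded_lipschitz_L2_closure[OF bounded_lipschitz_const[of 0]] by simp
  next
    case (compl A)
    have "(\<lambda>x. 1 + (- 1) * indicator A x) \<in> L2_closure \<nu> S"
      by (intro L2_closure_add L2_closure_cmult compl bounded_lipschitz_L2_closure bounded_lipschitz_const)
    then show ?case by (rule L2_closure_cong) (auto simp: sp indicator_def)
  next
    case (union A)
    have A: "A i \<in> sets \<nu>" for i
      using union(2) by (auto simp: sets_\<nu> sets_restrict_borel_eq_sigma_closed)
    show ?case
    proof (rule L2_closure_dominated_limit[where \<Phi> = "\<lambda>k x. \<Sum>i<k. indicator (A i) x" and w = "\<lambda>_. 1"])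
      have eq: "(\<Sum>i<k. indicator (A i) x) = indicat_real (\<Union>i<k. A i) x" for k x
        using disjoint_family_on_mono[OF subset_UNIV union(1)] by (simp add: indicator_UN_disjoint)
      show "(\<lambda>k. \<Sum>i<k. indicat_real (A i) x) \<longlonglongrightarrow> indicator (\<Union>i. A i) x" for x
        unfolding eq by (rule LIMSEQ_indicator_UN)
      show "((\<Sum>i<k. indicat_real (A i) x) - indicator (\<Union>i. A i) x)\<^sup>2 \<le> 1" for k x
        unfolding eq by (auto simp: indicator_def)
      show "(\<lambda>x. \<Sum>i<k. indicat_real (A i) x) \<in> L2_closure \<nu> S" for k
        by (intro L2_closure_sum union) simp
      show "indicat_real (\<Union>i. A i) \<in> borel_measurable \<nu>"
        using A by (intro borel_measurable_indicator) auto
    qed simp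
  qed
qed

text \<open>
  A square integrable function is a limit of simple functions dominated by twice its absolute
  value, and simple functions are linear combinations of indicators.
\<close>

lemma bounded_lipschitz_dense_L2:
  assumes "\<Phi> \<in> square_integrable \<nu>" "0 < \<epsilon>"
  obtains \<Psi> where "\<Psi> \<in> bounded_lipschitz S" "sqdist \<nu> \<Phi> \<Psi> \<le> ennreal \<epsilon>"
proof -
  have [measurable]: "\<Phi> \<in> borel_measurable \<nu>" and int: "integrable \<nu> (\<lambda>x. (\<Phi> x)\<^sup>2)"
    using assms(1) by (auto simp: square_integrable_def)
  obtain s where s: "\<forall>i. simple_function \<nu> (s i)" "\<forall>x\<in>space \<nu>. (\<lambda>i. s i x) \<longlonglongrightarrow> \<Phi> x"
    "\<forall>i. \<forall>x\<in>space \<nu>. dist (s i x) 0 \<le> 2 * dist (\<Phi> x) 0"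
    using borel_measurable_implies_sequence_metric[OF \<open>\<Phi> \<in> borel_measurable \<nu>\<close>, of 0] by metis
  have "\<Phi> \<in> L2_closure \<nu> S"
  proof (rule L2_closure_dominated_limit[where \<Phi> = s and w = "\<lambda>x. 9 * (\<Phi> x)\<^sup>2"])
    show "s i \<in> L2_closure \<nu> S" for i
    proof -
      have "(\<lambda>x. \<Sum>y\<in>s i ` space \<nu>. y * indicator (s i -` {y} \<inter> space \<nu>) x) \<in> L2_closure \<nu> S"
      proof (rule L2_closure_sum)
        show "finite (s i ` space \<nu>)" using s(1) by (simp add: simple_functionD)
        show "(\<lambda>x. y * indicator (s i -` {y} \<inter> space \<nu>) x) \<in> L2_closure \<nu> S" for y
          using s(1) by (intro L2_closure_cmult L2_closure_indicator) (simp add: simple_functionD)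
      qed
      moreover have "(\<Sum>y\<in>s i ` space \<nu>. y * indicator (s i -` {y} \<inter> space \<nu>) x) = s i x" if "x \<in> space \<nu>" for x
      proof -
        have "(\<Sum>y\<in>s i ` space \<nu>. y * indicator (s i -` {y} \<inter> space \<nu>) x)
            = (\<Sum>y\<in>s i ` space \<nu>. if y = s i x then y else 0)"
          using that by (intro sum.cong) (auto simp: indicator_def)
        also have "\<dots> = s i x" using that s(1) by (simp add: simple_function_def)
        finally show ?thesis .
      qed
      ultimately show ?thesis by (rule L2_closure_cong)
    qed
    show "(s i x - \<Phi> x)\<^sup>2 \<le> 9 * (\<Phi> x)\<^sup>2" if "x \<in> space \<nu>" for i x
    proof -
      have "\<bar>s i x\<bar> \<le> 2 * \<bar>\<Phi> x\<bar>" using s(3) that by simp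
      then have "\<bar>s i x - \<Phi> x\<bar> \<le> \<bar>3 * \<Phi> x\<bar>" by linarith
      then have "(s i x - \<Phi> x)\<^sup>2 \<le> (3 * \<Phi> x)\<^sup>2" by (simp only: abs_le_square_iff)
      then show ?thesis by (simp add: power_mult_distrib)
    qed
    show "integrable \<nu> (\<lambda>x. 9 * (\<Phi> x)\<^sup>2)" using int by simp
    show "(\<lambda>i. s i x) \<longlonglongrightarrow> \<Phi> x" if "x \<in> space \<nu>" for x using s(2) that by simp
  qed simp
  then have "\<exists>\<Psi>\<in>bounded_lipschitz S. sqdist \<nu> \<Phi> \<Psi> \<le> ennreal \<epsilon>"
    using assms(2) by (simp add: L2_closure_def)
  then show thesis using that by blast
qed

end

section \<open>Averages and their limits\<close>

text \<open>
  Nonnegativity of the variance; the extended integral covers the case of an infinite second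
  moment.
\<close>

lemma (in prob_space) ennreal_square_expectation_le:
  fixes h :: "'a \<Rightarrow> real"
  assumes h: "integrable M h"
  shows "ennreal ((\<integral>\<omega>. h \<omega> \<partial>M)\<^sup>2) \<le> (\<integral>\<^sup>+\<omega>. ennreal ((h \<omega>)\<^sup>2) \<partial>M)"
proof (cases "integrable M (\<lambda>\<omega>. (h \<omega>)\<^sup>2)")
  case True
  have "(\<integral>\<omega>. h \<omega> \<partial>M)\<^sup>2 \<le> (\<integral>\<omega>. (h \<omega>)\<^sup>2 \<partial>M)"
    using variance_eq[OF h True] variance_positive[of h] by simp
  then show ?thesis
    using True by (subst nn_integral_eq_integral) (auto intro: ennreal_leI)
next
  case False
  then have "(\<integral>\<^sup>+\<omega>. ennreal ((h \<omega>)\<^sup>2) \<partial>M) = \<infinity>"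
    using borel_measurable_integrable[OF h] by (simp add: integrable_iff_bounded less_top[symmetric])
  then show ?thesis by simp
qed

lemma ennreal_tendsto_0I:
  assumes "\<And>\<epsilon>. 0 < \<epsilon> \<Longrightarrow> eventually (\<lambda>k. a k \<le> ennreal \<epsilon>) F"
  shows "(a \<longlongrightarrow> (0::ennreal)) F"
proof (rule order_tendstoI)
  fix b :: ennreal assume "0 < b"
  then obtain c where c: "0 < c" "c < b" using dense by blast
  from c(2) have "c < \<top>" by (rule less_le_trans) simp
  then have eq: "ennreal (enn2real c) = c" by simp
  with c have "0 < enn2real c" by (metis ennreal_less_zero_iff)
  from assms[OF this] show "eventually (\<lambda>k. a k < b) F"
    unfolding eq by eventually_elim (use c in \<open>auto intro: le_less_trans\<close>)
qed simp

lemma cesaro_null: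
  fixes r :: "nat \<Rightarrow> real"
  assumes "r \<longlonglongrightarrow> 0"
  shows "(\<lambda>n. (1 / real n) * (\<Sum>m<n. r m)) \<longlonglongrightarrow> 0"
proof (rule LIMSEQ_I)
  fix \<epsilon> :: real assume "0 < \<epsilon>"
  then obtain K where K: "\<And>m. K \<le> m \<Longrightarrow> \<bar>r m\<bar> < \<epsilon> / 2"
    using LIMSEQ_D[OF assms, of "\<epsilon> / 2"] by auto
  define C where "C = (\<Sum>m<K. \<bar>r m\<bar>)"
  have "(\<lambda>n. C / real n) \<longlonglongrightarrow> 0"
    by (rule tendsto_divide_0[OF tendsto_const]) (rule filterlim_at_top_imp_at_infinity[OF filterlim_real_sequentially])
  then obtain n0 where n0: "\<And>n. n0 \<le> n \<Longrightarrow> \<bar>C / real n\<bar> < \<epsilon> / 2"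
    using LIMSEQ_D[of "\<lambda>n. C / real n" 0 "\<epsilon> / 2"] \<open>0 < \<epsilon>\<close> by auto
  have "\<bar>(1 / real n) * (\<Sum>m<n. r m)\<bar> < \<epsilon>" if n: "max (max K n0) 1 \<le> n" for n
  proof -
    have "(\<Sum>m<n. r m) = (\<Sum>m<K. r m) + (\<Sum>m=K..<n. r m)"
      using n by (simp add: lessThan_atLeast0 sum.atLeastLessThan_concat)
    then have "\<bar>\<Sum>m<n. r m\<bar> \<le> \<bar>\<Sum>m<K. r m\<bar> + \<bar>\<Sum>m=K..<n. r m\<bar>" by simp
    also have "\<dots> \<le> C + (\<Sum>m=K..<n. \<bar>r m\<bar>)"
      unfolding C_def by (intro add_mono sum_abs)
    also have "(\<Sum>m=K..<n. \<bar>r m\<bar>) \<le> (\<Sum>m=K..<n. \<epsilon> / 2)"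
      using K by (intro sum_mono less_imp_le) simp
    also have "\<dots> \<le> real n * (\<epsilon> / 2)"
      using \<open>0 < \<epsilon>\<close> by (simp add: mult_right_mono)
    finally have "\<bar>\<Sum>m<n. r m\<bar> \<le> C + real n * (\<epsilon> / 2)" by simp
    then have "\<bar>\<Sum>m<n. r m\<bar> / real n \<le> C / real n + \<epsilon> / 2"
      using n by (simp add: field_simps)
    also have "\<dots> < \<epsilon>" using abs_ge_self[of "C / real n"] n0[of n] n by linarith
    finally show ?thesis using n by (simp add: abs_mult)
  qed
  then show "\<exists>n0. \<forall>n\<ge>n0. norm ((1 / real n) * (\<Sum>m<n. r m) - 0) < \<epsilon>"
    by (intro exI[of _ "max (max K n0) 1"]) (simp only: diff_0_right real_norm_def, blast)
qed

section \<open>Chains driven by a contraction and additive noise\<close>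

text \<open>
  The chain $x \mapsto f(x) + g(\omega)$ on a closed subspace \<open>S\<close>. The map \<open>f\<close> and the transition
  operator below are defined on the whole space, but only their behaviour on \<open>S\<close> is controlled.
\<close>

locale random_contraction = prob_space M for M :: "'w measure" +
  fixes S :: "'a::{real_normed_vector, polish_space} set"
    and f :: "'a \<Rightarrow> 'a" and g :: "'w \<Rightarrow> 'a" and \<kappa> :: real
  assumes closed_S: "closed S" and subspace_S: "subspace S"
    and f_S: "\<And>x. x \<in> S \<Longrightarrow> f x \<in> S"
    and f_lipschitz: "\<kappa>-lipschitz_on S f" and \<kappa>_less: "\<kappa> < 1"
    and g_measurable [measurable]: "g \<in> measurable M (restrict_space borel S)"
    and g_integrable: "integrable M (\<lambda>\<omega>. norm (g \<omega>))"
begin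

abbreviation N :: "'a measure" where "N \<equiv> restrict_space borel S"

definition kernel_op :: "('a \<Rightarrow> real) \<Rightarrow> 'a \<Rightarrow> real" where
  "kernel_op \<Phi> x = (\<integral>\<omega>. \<Phi> (f x + g \<omega>) \<partial>M)"

lemma space_N [simp]: "space N = S"
  by (simp add: space_restrict_space)

lemma N_borel: "h \<in> measurable L N \<Longrightarrow> h \<in> measurable L borel"
  by (simp add: measurable_restrict_space2_iff)

lemma N_space: "h \<in> measurable L N \<Longrightarrow> \<omega> \<in> space L \<Longrightarrow> h \<omega> \<in> S"
  by (auto dest: measurable_space)

lemma \<kappa>_nonneg: "0 \<le> \<kappa>"
  using f_lipschitz by (rule lipschitz_on_nonneg)

lemma step_S: "x \<in> S \<Longrightarrow> \<omega> \<in> space M \<Longrightarrow> f x + g \<omega> \<in> S"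
  using f_S N_space[OF g_measurable] subspace_add[OF subspace_S] by blast

lemma f_measurable [measurable]: "f \<in> measurable N N"
proof (rule measurable_restrict_space2)
  show "f \<in> space N \<rightarrow> S" using f_S by auto
  show "f \<in> borel_measurable N"
    using f_lipschitz by (intro borel_measurable_continuous_on_restrict lipschitz_on_continuous_on)
qed

lemma add_measurable_N:
  assumes h: "h \<in> measurable L N" and k: "k \<in> measurable L N"
  shows "(\<lambda>\<omega>. h \<omega> + k \<omega>) \<in> measurable L N"
proof (rule measurable_restrict_space2)
  show "(\<lambda>\<omega>. h \<omega> + k \<omega>) \<in> space L \<rightarrow> S"
    using N_space[OF h] N_space[OF k] subspace_add[OF subspace_S] by auto
  show "(\<lambda>\<omega>. h \<omega> + k \<omega>) \<in> borel_measurable L"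
    using h k by (intro borel_measurable_add N_borel)
qed

lemma step_measurable [measurable]: "(\<lambda>(x, \<omega>). f x + g \<omega>) \<in> measurable (N \<Otimes>\<^sub>M M) N"
  unfolding split_beta' by (rule add_measurable_N) measurable

lemma step_measurable_at: "x \<in> S \<Longrightarrow> (\<lambda>\<omega>. f x + g \<omega>) \<in> measurable M N"
  using measurable_compose[OF measurable_Pair1' step_measurable, of x] by simp

lemma kernel_op_measurable:
  assumes [measurable]: "\<Phi> \<in> borel_measurable N"
  shows "kernel_op \<Phi> \<in> borel_measurable N"
proof -
  have "(\<lambda>(x, \<omega>). \<Phi> (f x + g \<omega>)) \<in> borel_measurable (N \<Otimes>\<^sub>M M)"
    using measurable_compose[OF step_measurable assms] by (simp add: split_beta')
  then show ?thesis
    unfolding kernel_op_def[abs_def] by (rule borel_measurable_lebesgue_integral)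
qed

lemma step_integrable:
  assumes "\<Phi> \<in> bounded_borel S" "x \<in> S"
  shows "integrable M (\<lambda>\<omega>. \<Phi> (f x + g \<omega>))"
proof -
  obtain b where b: "\<And>x. x \<in> S \<Longrightarrow> \<bar>\<Phi> x\<bar> \<le> b" and [measurable]: "\<Phi> \<in> borel_measurable N"
    using assms(1) by (auto simp: bounded_borel_def bounded_iff)
  show ?thesis
    using b step_S[OF \<open>x \<in> S\<close>] measurable_compose[OF step_measurable_at[OF \<open>x \<in> S\<close>] \<open>\<Phi> \<in> borel_measurable N\<close>]
    by (intro integrable_const_bound[where B = b] AE_I2) auto
qed

lemma kernel_op_bound:
  assumes "\<Phi> \<in> bounded_borel S" "\<And>x. x \<in> S \<Longrightarrow> \<bar>\<Phi> x\<bar> \<le> b" "x \<in> S"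
  shows "\<bar>kernel_op \<Phi> x\<bar> \<le> b"
proof -
  have "\<bar>kernel_op \<Phi> x\<bar> \<le> (\<integral>\<omega>. \<bar>\<Phi> (f x + g \<omega>)\<bar> \<partial>M)"
    unfolding kernel_op_def by (rule integral_abs_bound)
  also have "\<dots> \<le> (\<integral>\<omega>. b \<partial>M)"
    using assms step_S step_integrable[OF assms(1,3)] by (intro integral_mono) auto
  finally show ?thesis by (simp add: prob_space)
qed

lemma kernel_op_bounded_borel:
  assumes "\<Phi> \<in> bounded_borel S"
  shows "kernel_op \<Phi> \<in> bounded_borel S"
proof -
  obtain b where "\<And>x. x \<in> S \<Longrightarrow> \<bar>\<Phi> x\<bar> \<le> b"
    using assms by (auto simp: bounded_borel_def bounded_iff)
  then show ?thesis
    using kernel_op_bound[OF assms] kernel_op_measurable assms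
    by (auto simp: bounded_borel_def bounded_iff)
qed

text \<open>
  Synchronous coupling: in $\Phi(f(x) + g) - \Phi(f(y) + g)$ the common noise cancels from the
  distance of the arguments, and only the contraction by \<open>f\<close> remains.
\<close>

lemma kernel_op_lipschitz:
  assumes \<Phi>: "\<Phi> \<in> bounded_borel S" and lip: "C-lipschitz_on S \<Phi>"
  shows "(C * \<kappa>)-lipschitz_on S (kernel_op \<Phi>)"
proof (rule lipschitz_onI)
  fix x y assume xy: "x \<in> S" "y \<in> S"
  note int = step_integrable[OF \<Phi> xy(1)] step_integrable[OF \<Phi> xy(2)]
  have "\<bar>kernel_op \<Phi> x - kernel_op \<Phi> y\<bar> = \<bar>\<integral>\<omega>. \<Phi> (f x + g \<omega>) - \<Phi> (f y + g \<omega>) \<partial>M\<bar>"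
    unfolding kernel_op_def using int by simp
  also have "\<dots> \<le> (\<integral>\<omega>. \<bar>\<Phi> (f x + g \<omega>) - \<Phi> (f y + g \<omega>)\<bar> \<partial>M)"
    by (rule integral_abs_bound)
  also have "\<dots> \<le> (\<integral>\<omega>. C * (\<kappa> * dist x y) \<partial>M)"
  proof (rule integral_mono)
    fix \<omega> assume \<omega>: "\<omega> \<in> space M"
    have "\<bar>\<Phi> (f x + g \<omega>) - \<Phi> (f y + g \<omega>)\<bar> \<le> C * dist (f x + g \<omega>) (f y + g \<omega>)"
      using lipschitz_onD[OF lip step_S[OF xy(1) \<omega>] step_S[OF xy(2) \<omega>]] by (simp add: dist_real_def)
    also have "\<dots> = C * dist (f x) (f y)" by (simp add: dist_norm)
    also have "\<dots> \<le> C * (\<kappa> * dist x y)"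
      using lipschitz_onD[OF f_lipschitz xy] lipschitz_on_nonneg[OF lip] by (rule mult_left_mono)
    finally show "\<bar>\<Phi> (f x + g \<omega>) - \<Phi> (f y + g \<omega>)\<bar> \<le> C * (\<kappa> * dist x y)" .
  qed (use int in auto)
  finally show "dist (kernel_op \<Phi> x) (kernel_op \<Phi> y) \<le> C * \<kappa> * dist x y"
    by (simp add: prob_space dist_real_def mult.assoc)
qed (use \<kappa>_nonneg lipschitz_on_nonneg[OF lip] in simp)

lemma kernel_op_funpow_bounded_borel:
  "\<Phi> \<in> bounded_borel S \<Longrightarrow> (kernel_op ^^ m) \<Phi> \<in> bounded_borel S"
  by (induction m) (auto intro: kernel_op_bounded_borel)

lemma kernel_op_funpow_bound:
  assumes "\<Phi> \<in> bounded_borel S" "\<And>x. x \<in> S \<Longrightarrow> \<bar>\<Phi> x\<bar> \<le> b" "x \<in> S"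
  shows "\<bar>(kernel_op ^^ m) \<Phi> x\<bar> \<le> b"
  using assms(3)
  by (induction m arbitrary: x) (auto intro!: kernel_op_bound kernel_op_funpow_bounded_borel assms)

lemma kernel_op_funpow_lipschitz:
  assumes "\<Phi> \<in> bounded_borel S" "C-lipschitz_on S \<Phi>"
  shows "(C * \<kappa> ^ m)-lipschitz_on S ((kernel_op ^^ m) \<Phi>)"
proof (induction m)
  case (Suc m)
  show ?case
    using kernel_op_lipschitz[OF kernel_op_funpow_bounded_borel[OF assms(1)] Suc]
    by (simp add: mult_ac)
qed (simp add: assms)

section \<open>Invariant measures\<close>

text \<open>
  Invariance says that the law of $f(x) + g(\omega)$ is again $\nu$ if $x$ has law $\nu$ and is
  independent of the noise. In this form it extends from bounded functions to all nonnegative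
  measurable functions, which the $L^2$ theory needs.
\<close>

lemma invariant_iff_distr:
  assumes \<nu>: "prob_space \<nu>" "sets \<nu> = sets N"
  shows "invariant_prob S kernel_op \<nu> \<longleftrightarrow> distr (\<nu> \<Otimes>\<^sub>M M) N (\<lambda>(x, \<omega>). f x + g \<omega>) = \<nu>"
proof -
  interpret \<nu>: prob_space \<nu> by fact
  interpret R: pair_prob_space \<nu> M ..
  have step: "(\<lambda>(x, \<omega>). f x + g \<omega>) \<in> measurable (\<nu> \<Otimes>\<^sub>M M) N"
    using step_measurable by (simp cong: measurable_cong_sets add: \<nu>(2) cong: sets_pair_measure_cong)
  let ?D = "distr (\<nu> \<Otimes>\<^sub>M M) N (\<lambda>(x, \<omega>). f x + g \<omega>)"
  have sp: "space \<nu> = S" using sets_eq_imp_space_eq[OF \<nu>(2)] by simp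
  interpret D: prob_space ?D by (rule R.prob_space_distr[OF step])
  have D: "(\<integral>x. \<Phi> x \<partial>?D) = (\<integral>x. kernel_op \<Phi> x \<partial>\<nu>)" if \<Phi>: "\<Phi> \<in> bounded_borel S" for \<Phi>
  proof -
    obtain b where b: "\<And>x. x \<in> S \<Longrightarrow> \<bar>\<Phi> x\<bar> \<le> b" and meas [measurable]: "\<Phi> \<in> borel_measurable N"
      using \<Phi> by (auto simp: bounded_borel_def bounded_iff)
    have "integrable (\<nu> \<Otimes>\<^sub>M M) (\<lambda>z. \<Phi> (case z of (x, \<omega>) \<Rightarrow> f x + g \<omega>))"
      using b measurable_compose[OF step meas]
      by (intro R.integrable_const_bound[where B = b] AE_I2)
        (auto simp: space_pair_measure sp step_S)
    then have "(\<integral>x. (\<integral>\<omega>. \<Phi> (f x + g \<omega>) \<partial>M) \<partial>\<nu>) = (\<integral>z. \<Phi> (case z of (x, \<omega>) \<Rightarrow> f x + g \<omega>) \<partial>(\<nu> \<Otimes>\<^sub>M M))"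
      by (subst R.integral_fst) (auto simp: split_beta')
    also have "\<dots> = (\<integral>x. \<Phi> x \<partial>?D)"
      by (rule integral_distr[symmetric, OF step meas])
    finally show ?thesis by (simp add: kernel_op_def)
  qed
  show ?thesis
  proof
    assume "?D = \<nu>"
    with D \<nu> show "invariant_prob S kernel_op \<nu>" by (simp add: invariant_prob_def)
  next
    assume inv: "invariant_prob S kernel_op \<nu>"
    show "?D = \<nu>"
    proof (rule prob_eqI_bounded_lipschitz)
      fix \<Phi> assume "\<Phi> \<in> bounded_lipschitz S"
      then have "\<Phi> \<in> bounded_borel S" by (rule bounded_lipschitz_bounded_borel)
      with inv D show "(\<integral>x. \<Phi> x \<partial>?D) = (\<integral>x. \<Phi> x \<partial>\<nu>)" by (simp add: invariant_prob_def)
    qed (use \<nu> D.prob_space_axioms in auto)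
  qed
qed

end

locale invariant_random_contraction = random_contraction M S f g \<kappa>
  for M :: "'w measure" and S :: "'a::{real_normed_vector, polish_space} set" and f g \<kappa> +
  fixes \<nu> :: "'a measure"
  assumes inv: "invariant_prob S kernel_op \<nu>"
begin

sublocale \<nu>: prob_space \<nu>
  using inv by (simp add: invariant_prob_def)

interpretation R: pair_prob_space \<nu> M ..

lemma sets_inv: "sets \<nu> = sets N" and space_inv: "space \<nu> = S"
  using inv sets_eq_imp_space_eq[of \<nu> N] by (auto simp: invariant_prob_def)

lemma measurable_inv: "measurable \<nu> L = measurable N L"
  by (rule measurable_cong_sets[OF sets_inv refl])

lemma step_measurable_inv: "(\<lambda>(x, \<omega>). f x + g \<omega>) \<in> measurable (\<nu> \<Otimes>\<^sub>M M) N"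
  using step_measurable measurable_cong_sets[OF sets_pair_measure_cong[OF sets_inv refl] refl, of M N]
  by simp

lemma bounded_borel_integrable:
  assumes "\<Phi> \<in> bounded_borel S"
  shows "integrable \<nu> \<Phi>"
proof -
  obtain b where b: "\<And>x. x \<in> S \<Longrightarrow> \<bar>\<Phi> x\<bar> \<le> b" and meas: "\<Phi> \<in> borel_measurable N"
    using assms by (auto simp: bounded_borel_def bounded_iff)
  then show ?thesis
    by (intro \<nu>.integrable_const_bound[where B = b] AE_I2) (auto simp: space_inv measurable_inv)
qed

lemma nn_integral_step_inv:
  assumes "h \<in> borel_measurable N"
  shows "(\<integral>\<^sup>+x. \<integral>\<^sup>+\<omega>. h (f x + g \<omega>) \<partial>M \<partial>\<nu>) = (\<integral>\<^sup>+x. h x \<partial>\<nu>)"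
proof -
  have D: "distr (\<nu> \<Otimes>\<^sub>M M) N (\<lambda>(x, \<omega>). f x + g \<omega>) = \<nu>"
    using inv invariant_iff_distr[OF \<nu>.prob_space_axioms sets_inv] by blast
  have "(\<integral>\<^sup>+x. h x \<partial>\<nu>) = (\<integral>\<^sup>+x. h x \<partial>distr (\<nu> \<Otimes>\<^sub>M M) N (\<lambda>(x, \<omega>). f x + g \<omega>))"
    by (simp only: D)
  also have "\<dots> = (\<integral>\<^sup>+z. h (case z of (x, \<omega>) \<Rightarrow> f x + g \<omega>) \<partial>(\<nu> \<Otimes>\<^sub>M M))"
    using assms by (intro nn_integral_distr step_measurable_inv) simp
  also have "\<dots> = (\<integral>\<^sup>+x. \<integral>\<^sup>+\<omega>. h (f x + g \<omega>) \<partial>M \<partial>\<nu>)"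
    using nn_integral_fst[OF measurable_compose[OF step_measurable_inv assms]] by simp
  finally show ?thesis by simp
qed

lemma integral_kernel_op_funpow:
  assumes "\<Phi> \<in> bounded_borel S"
  shows "(\<integral>x. (kernel_op ^^ m) \<Phi> x \<partial>\<nu>) = (\<integral>x. \<Phi> x \<partial>\<nu>)"
proof (induction m)
  case (Suc m)
  with kernel_op_funpow_bounded_borel[OF assms, of m] inv show ?case
    by (simp add: invariant_prob_def)
qed simp

text \<open>
  By invariance the limit equals $\int P^m \Phi \, d\nu$ for every $m$, and
  $P^m \Phi(y) - P^m \Phi(x)$ tends to 0 for all $x$, $y$ as the Lipschitz constant of $P^m \Phi$ does.
\<close>

lemma kernel_op_funpow_tendsto:
  assumes \<Phi>: "\<Phi> \<in> bounded_lipschitz S" and x: "x \<in> S"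
  shows "(\<lambda>m. (kernel_op ^^ m) \<Phi> x) \<longlonglongrightarrow> (\<integral>y. \<Phi> y \<partial>\<nu>)"
proof -
  obtain b C where lip: "C-lipschitz_on S \<Phi>" and b: "\<And>x. x \<in> S \<Longrightarrow> \<bar>\<Phi> x\<bar> \<le> b"
    using \<Phi> by (auto simp: bounded_lipschitz_def)
  note bb = bounded_lipschitz_bounded_borel[OF \<Phi>]
  note bbm = kernel_op_funpow_bounded_borel[OF bb]
  have "(\<lambda>m. \<integral>y. (kernel_op ^^ m) \<Phi> y - (kernel_op ^^ m) \<Phi> x \<partial>\<nu>) \<longlonglongrightarrow> (\<integral>y. 0 \<partial>\<nu>)"
  proof (rule integral_dominated_convergence[where w = "\<lambda>_. 2 * b"])
    show "(\<lambda>y. (kernel_op ^^ m) \<Phi> y - (kernel_op ^^ m) \<Phi> x) \<in> borel_measurable \<nu>" for m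
      using borel_measurable_integrable[OF bounded_borel_integrable[OF bbm, of m]] by simp
    show "AE y in \<nu>. norm ((kernel_op ^^ m) \<Phi> y - (kernel_op ^^ m) \<Phi> x) \<le> 2 * b" for m
    proof (rule AE_I2)
      fix y assume "y \<in> space \<nu>"
      then have "y \<in> S" by (simp add: space_inv)
      then show "norm ((kernel_op ^^ m) \<Phi> y - (kernel_op ^^ m) \<Phi> x) \<le> 2 * b"
        using kernel_op_funpow_bound[OF bb b \<open>y \<in> S\<close>, of m] kernel_op_funpow_bound[OF bb b x, of m] by simp
    qed
    show "AE y in \<nu>. (\<lambda>m. (kernel_op ^^ m) \<Phi> y - (kernel_op ^^ m) \<Phi> x) \<longlonglongrightarrow> 0"
    proof (rule AE_I2)
      fix y assume "y \<in> space \<nu>"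
      then have y: "y \<in> S" by (simp add: space_inv)
      have "norm ((kernel_op ^^ m) \<Phi> y - (kernel_op ^^ m) \<Phi> x) \<le> C * \<kappa> ^ m * dist y x" for m
        using lipschitz_on_normD[OF kernel_op_funpow_lipschitz[OF bb lip] y x] by (simp add: dist_norm)
      moreover have "(\<lambda>m. \<kappa> ^ m) \<longlonglongrightarrow> 0"
        using \<kappa>_nonneg \<kappa>_less by (intro LIMSEQ_power_zero) simp
      then have "(\<lambda>m. C * \<kappa> ^ m * dist y x) \<longlonglongrightarrow> 0"
        by (intro tendsto_mult_left_zero tendsto_mult_right_zero)
      ultimately show "(\<lambda>m. (kernel_op ^^ m) \<Phi> y - (kernel_op ^^ m) \<Phi> x) \<longlonglongrightarrow> 0"
        by (rule Lim_null_comparison[OF always_eventually, OF allI])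
    qed
  qed auto
  moreover have "(\<integral>y. (kernel_op ^^ m) \<Phi> y - (kernel_op ^^ m) \<Phi> x \<partial>\<nu>) = (\<integral>y. \<Phi> y \<partial>\<nu>) - (kernel_op ^^ m) \<Phi> x" for m
    using bounded_borel_integrable[OF bbm, of m] integral_kernel_op_funpow[OF bb]
    by (simp add: \<nu>.prob_space)
  ultimately have "(\<lambda>m. (\<integral>y. \<Phi> y \<partial>\<nu>) - (kernel_op ^^ m) \<Phi> x) \<longlonglongrightarrow> 0" by simp
  then have "(\<lambda>m. (\<integral>y. \<Phi> y \<partial>\<nu>) - ((\<integral>y. \<Phi> y \<partial>\<nu>) - (kernel_op ^^ m) \<Phi> x)) \<longlonglongrightarrow> (\<integral>y. \<Phi> y \<partial>\<nu>) - 0"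
    by (intro tendsto_diff tendsto_const)
  then show ?thesis by simp
qed

section \<open>The transition operator on square integrable functions\<close>

lemma square_integrable_integrable:
  assumes "\<Phi> \<in> square_integrable \<nu>"
  shows "integrable \<nu> \<Phi>"
  using assms by (intro \<nu>.square_integrable_imp_integrable[of \<Phi>]) (simp_all add: square_integrable_def)

text \<open>
  Jensen's inequality followed by invariance. The expectation defining $P \Phi(x)$ need exist only
  for $\nu$-almost all $x$, so linearity of the operator is available only almost everywhere; stating
  the contraction for the distance of two images absorbs this.
\<close>

lemma kernel_op_square_integrable_contraction:
  assumes \<Phi>: "\<Phi> \<in> square_integrable \<nu>" and \<Psi>: "\<Psi> \<in> square_integrable \<nu>"
  shows "sqdist \<nu> (kernel_op \<Phi>) (kernel_op \<Psi>) \<le> sqdist \<nu> \<Phi> \<Psi>"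
proof -
  have meas: "\<Phi> \<in> borel_measurable N" "\<Psi> \<in> borel_measurable N"
    using \<Phi> \<Psi> by (auto simp: square_integrable_def measurable_inv)
  have AE_int: "AE x in \<nu>. integrable M (\<lambda>\<omega>. \<Xi> (f x + g \<omega>))" if \<Xi>: "\<Xi> \<in> square_integrable \<nu>" for \<Xi>
  proof -
    have "\<Xi> \<in> borel_measurable N"
      using \<Xi> by (simp add: square_integrable_def measurable_inv)
    have "integrable \<nu> \<Xi>"
      using \<Xi> by (rule square_integrable_integrable)
    then have "integrable (distr (\<nu> \<Otimes>\<^sub>M M) N (\<lambda>(x, \<omega>). f x + g \<omega>)) \<Xi>"
      using inv invariant_iff_distr[OF \<nu>.prob_space_axioms sets_inv] by simp
    then have "integrable (\<nu> \<Otimes>\<^sub>M M) (\<lambda>z. \<Xi> (case z of (x, \<omega>) \<Rightarrow> f x + g \<omega>))"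
      using integrable_distr_eq[OF step_measurable_inv \<open>\<Xi> \<in> borel_measurable N\<close>] by simp
    then have "integrable (\<nu> \<Otimes>\<^sub>M M) (\<lambda>(x, \<omega>). \<Xi> (f x + g \<omega>))"
      by (simp add: split_beta')
    then show ?thesis by (rule R.AE_integrable_fst)
  qed
  have "sqdist \<nu> (kernel_op \<Phi>) (kernel_op \<Psi>) \<le> (\<integral>\<^sup>+x. \<integral>\<^sup>+\<omega>. ennreal ((\<Phi> (f x + g \<omega>) - \<Psi> (f x + g \<omega>))\<^sup>2) \<partial>M \<partial>\<nu>)"
    unfolding sqdist_def
  proof (rule nn_integral_mono_AE)
    show "AE x in \<nu>. ennreal ((kernel_op \<Phi> x - kernel_op \<Psi> x)\<^sup>2)
        \<le> (\<integral>\<^sup>+\<omega>. ennreal ((\<Phi> (f x + g \<omega>) - \<Psi> (f x + g \<omega>))\<^sup>2) \<partial>M)"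
      using AE_int[OF \<Phi>] AE_int[OF \<Psi>]
    proof eventually_elim
      case (elim x)
      then have "kernel_op \<Phi> x - kernel_op \<Psi> x = (\<integral>\<omega>. \<Phi> (f x + g \<omega>) - \<Psi> (f x + g \<omega>) \<partial>M)"
        by (simp add: kernel_op_def)
      moreover have "integrable M (\<lambda>\<omega>. \<Phi> (f x + g \<omega>) - \<Psi> (f x + g \<omega>))"
        using elim by (rule Bochner_Integration.integrable_diff)
      ultimately show ?case
        using ennreal_square_expectation_le by metis
    qed
  qed
  also have "\<dots> = sqdist \<nu> \<Phi> \<Psi>"
    unfolding sqdist_def
    by (rule nn_integral_step_inv[of "\<lambda>y. ennreal ((\<Phi> y - \<Psi> y)\<^sup>2)"]) (use meas in measurable)
  finally show ?thesis .
qed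

lemma square_integrable_iff_sqdist:
  "\<Phi> \<in> square_integrable \<nu> \<longleftrightarrow> \<Phi> \<in> borel_measurable \<nu> \<and> sqdist \<nu> \<Phi> (\<lambda>_. 0) < \<infinity>"
  by (auto simp: square_integrable_def sqdist_def integrable_iff_bounded)

lemma kernel_op_square_integrable:
  assumes "\<Phi> \<in> square_integrable \<nu>"
  shows "kernel_op \<Phi> \<in> square_integrable \<nu>"
proof -
  have "(\<lambda>_. 0) \<in> square_integrable \<nu>" by (simp add: square_integrable_def)
  from kernel_op_square_integrable_contraction[OF assms this]
  have "sqdist \<nu> (kernel_op \<Phi>) (\<lambda>_. 0) \<le> sqdist \<nu> \<Phi> (\<lambda>_. 0)"
    by (simp add: kernel_op_def[abs_def])
  with assms show ?thesis
    by (auto simp: square_integrable_iff_sqdist measurable_inv intro: kernel_op_measurable)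
qed

lemma kernel_op_funpow_square_integrable:
  "\<Phi> \<in> square_integrable \<nu> \<Longrightarrow> (kernel_op ^^ m) \<Phi> \<in> square_integrable \<nu>"
  by (induction m) (auto intro: kernel_op_square_integrable)

lemma kernel_op_funpow_contraction:
  assumes "\<Phi> \<in> square_integrable \<nu>" "\<Psi> \<in> square_integrable \<nu>"
  shows "sqdist \<nu> ((kernel_op ^^ m) \<Phi>) ((kernel_op ^^ m) \<Psi>) \<le> sqdist \<nu> \<Phi> \<Psi>"
proof (induction m)
  case (Suc m)
  have "sqdist \<nu> ((kernel_op ^^ Suc m) \<Phi>) ((kernel_op ^^ Suc m) \<Psi>) \<le> sqdist \<nu> ((kernel_op ^^ m) \<Phi>) ((kernel_op ^^ m) \<Psi>)"
    using kernel_op_square_integrable_contraction[OF kernel_op_funpow_square_integrable[OF assms(1)]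
        kernel_op_funpow_square_integrable[OF assms(2)]] by simp
  with Suc show ?case by (rule order_trans[rotated])
qed simp

end

section \<open>Mixing, ergodicity and uniqueness\<close>

context invariant_random_contraction
begin

text \<open>
  The standard $\epsilon/3$ argument: approximate $\Phi$ by a bounded Lipschitz $\Psi$, for which
  the pointwise convergence is dominated; the error $P^m \Phi - P^m \Psi$ does not grow with $m$, and
  $|\int \Phi \, d\nu - \int \Psi \, d\nu|$ is bounded by the distance of $\Phi$ and $\Psi$.
\<close>

lemma kernel_op_funpow_mixing:
  assumes \<Phi>: "\<Phi> \<in> square_integrable \<nu>"
  shows "(\<lambda>m. sqdist \<nu> ((kernel_op ^^ m) \<Phi>) (\<lambda>_. \<integral>y. \<Phi> y \<partial>\<nu>)) \<longlonglongrightarrow> 0"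
proof (rule ennreal_tendsto_0I)
  fix \<epsilon> :: real assume "0 < \<epsilon>"
  \<comment> \<open>The triangle inequality is used twice below and costs a factor 4 each time.\<close>
  then have \<epsilon>: "0 < \<epsilon> / 4" "0 < \<epsilon> / 4 / 4" by simp_all
  obtain \<Psi> where \<Psi>: "\<Psi> \<in> bounded_lipschitz S" and dist: "sqdist \<nu> \<Phi> \<Psi> \<le> ennreal (\<epsilon> / 4 / 4)"
    using bounded_lipschitz_dense_L2[OF \<nu>.finite_measure_axioms sets_inv \<Phi> \<epsilon>(2)] .
  obtain b C where b: "\<And>x. x \<in> S \<Longrightarrow> \<bar>\<Psi> x\<bar> \<le> b"
    using \<Psi> by (auto simp: bounded_lipschitz_def)
  note bb = bounded_lipschitz_bounded_borel[OF \<Psi>]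
  have bb_sq: "\<Xi> \<in> square_integrable \<nu>" if \<Xi>: "\<Xi> \<in> bounded_borel S" for \<Xi>
  proof -
    obtain B where B: "\<And>x. x \<in> S \<Longrightarrow> \<bar>\<Xi> x\<bar> \<le> B"
      using \<Xi> by (auto simp: bounded_borel_def bounded_iff)
    have meas: "\<Xi> \<in> borel_measurable \<nu>"
      using bounded_borel_integrable[OF \<Xi>] by (rule borel_measurable_integrable)
    have "integrable \<nu> (\<lambda>x. (\<Xi> x)\<^sup>2)"
    proof (rule \<nu>.integrable_const_bound[where B = "B\<^sup>2"])
      show "AE x in \<nu>. norm ((\<Xi> x)\<^sup>2) \<le> B\<^sup>2"
        using B by (intro AE_I2) (simp add: space_inv abs_le_square_iff[symmetric] order_trans[OF _ abs_ge_self])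
    qed (use meas in measurable)
    with meas show ?thesis by (simp add: square_integrable_def)
  qed
  have \<Psi>_sq: "\<Psi> \<in> square_integrable \<nu>" by (rule bb_sq[OF bb])
  have meas: "(kernel_op ^^ m) \<Phi> \<in> borel_measurable \<nu>" "(kernel_op ^^ m) \<Psi> \<in> borel_measurable \<nu>" for m
    using kernel_op_funpow_square_integrable[OF \<Phi>, of m] kernel_op_funpow_square_integrable[OF \<Psi>_sq, of m]
    by (simp_all add: square_integrable_def)
  let ?c = "\<integral>y. \<Phi> y \<partial>\<nu>" and ?d = "\<integral>y. \<Psi> y \<partial>\<nu>"
  have "(\<lambda>m. sqdist \<nu> ((kernel_op ^^ m) \<Psi>) (\<lambda>_. ?d)) \<longlonglongrightarrow> 0"
  proof (rule sqdist_dominated_convergence[where w = "\<lambda>_. (2 * b)\<^sup>2"])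
    show "(\<lambda>m. (kernel_op ^^ m) \<Psi> x) \<longlonglongrightarrow> ?d" if "x \<in> space \<nu>" for x
      using kernel_op_funpow_tendsto[OF \<Psi>] that by (simp add: space_inv)
    have "\<bar>?d\<bar> \<le> (\<integral>x. \<bar>\<Psi> x\<bar> \<partial>\<nu>)" by (rule integral_abs_bound)
    also have "\<dots> \<le> (\<integral>x. b \<partial>\<nu>)"
      using bounded_borel_integrable[OF bb] b by (intro integral_mono) (simp_all add: space_inv)
    finally have d: "\<bar>?d\<bar> \<le> b" by (simp add: \<nu>.prob_space)
    show "((kernel_op ^^ m) \<Psi> x - ?d)\<^sup>2 \<le> (2 * b)\<^sup>2" if "x \<in> space \<nu>" for m x
    proof -
      have "\<bar>(kernel_op ^^ m) \<Psi> x - ?d\<bar> \<le> \<bar>2 * b\<bar>"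
        using kernel_op_funpow_bound[OF bb b, of x m] that d by (simp add: space_inv)
      then show ?thesis by (simp only: abs_le_square_iff)
    qed
  qed (use meas in simp_all)
  moreover have "0 < ennreal (\<epsilon> / 4 / 4)"
    using ennreal_lessI[OF \<epsilon>(2) \<epsilon>(2)] unfolding ennreal_0 .
  ultimately have "eventually (\<lambda>m. sqdist \<nu> ((kernel_op ^^ m) \<Psi>) (\<lambda>_. ?d) < ennreal (\<epsilon> / 4 / 4)) sequentially"
    by (rule order_tendstoD(2))
  then show "eventually (\<lambda>m. sqdist \<nu> ((kernel_op ^^ m) \<Phi>) (\<lambda>_. ?c) \<le> ennreal \<epsilon>) sequentially"
  proof eventually_elim
    case (elim m)
    have 0: "sqdist \<nu> ((kernel_op ^^ m) \<Phi>) ((kernel_op ^^ m) \<Psi>) \<le> ennreal (\<epsilon> / 4 / 4)"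
      using kernel_op_funpow_contraction[OF \<Phi> \<Psi>_sq] dist by (rule order_trans)
    have 1: "sqdist \<nu> ((kernel_op ^^ m) \<Phi>) (\<lambda>_. ?d) \<le> ennreal (\<epsilon> / 4)"
      by (rule sqdist_triangle_quarters[OF meas _ 0 less_imp_le[OF elim] \<epsilon>(1)]) simp
    have "(\<integral>y. \<Psi> y - \<Phi> y \<partial>\<nu>) = ?d - ?c"
      by (intro Bochner_Integration.integral_diff square_integrable_integrable \<Phi> \<Psi>_sq)
    then have "sqdist \<nu> (\<lambda>_. ?d) (\<lambda>_. ?c) = ennreal ((\<integral>y. \<Psi> y - \<Phi> y \<partial>\<nu>)\<^sup>2)"
      unfolding sqdist_def by (simp only: nn_integral_const \<nu>.emeasure_space_1 mult_1_right)
    also have "\<dots> \<le> sqdist \<nu> \<Psi> \<Phi>"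
      unfolding sqdist_def
      using square_integrable_integrable[OF \<Phi>] square_integrable_integrable[OF \<Psi>_sq]
      by (intro \<nu>.ennreal_square_expectation_le Bochner_Integration.integrable_diff)
    also have "\<dots> \<le> ennreal (\<epsilon> / 4)"
      using dist \<open>0 < \<epsilon>\<close> unfolding sqdist_commute[of \<nu> \<Psi>] by (elim order_trans) (intro ennreal_leI, simp)
    finally have 2: "sqdist \<nu> (\<lambda>_. ?d) (\<lambda>_. ?c) \<le> ennreal (\<epsilon> / 4)" .
    show ?case
      by (rule sqdist_triangle_quarters[OF meas(1) _ _ 1 2 \<open>0 < \<epsilon>\<close>]) simp_all
  qed
qed

text \<open>
  Convergence of $P^m \Phi$ passes to its averages, because the squared distance is convex.
\<close>

lemma invariant_ergodic: "ergodic_wrt kernel_op \<nu>"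
  unfolding ergodic_wrt_def
proof (intro ballI conjI allI)
  fix \<Phi> assume \<Phi>: "\<Phi> \<in> square_integrable \<nu>"
  note sq = kernel_op_funpow_square_integrable[OF \<Phi>]
  show "(kernel_op ^^ m) \<Phi> \<in> square_integrable \<nu>" for m by (rule sq)
  have meas: "(kernel_op ^^ m) \<Phi> \<in> borel_measurable \<nu>" for m
    using sq[of m] by (simp add: square_integrable_def)
  let ?c = "\<integral>y. \<Phi> y \<partial>\<nu>"
  \<comment> \<open>Averages are compared in the reals, where subtraction and division are available.\<close>
  define r where "r m = enn2real (sqdist \<nu> ((kernel_op ^^ m) \<Phi>) (\<lambda>_. ?c))" for m
  have finite: "sqdist \<nu> ((kernel_op ^^ m) \<Phi>) (\<lambda>_. ?c) < \<top>" for m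
  proof -
    have "sqdist \<nu> ((kernel_op ^^ m) \<Phi>) (\<lambda>_. ?c)
        \<le> 2 * sqdist \<nu> ((kernel_op ^^ m) \<Phi>) (\<lambda>_. 0) + 2 * sqdist \<nu> (\<lambda>_. 0) (\<lambda>_. ?c)"
      using meas by (intro sqdist_triangle) simp_all
    also have "sqdist \<nu> (\<lambda>_. 0) (\<lambda>_. ?c) = ennreal (?c\<^sup>2)"
      by (simp add: sqdist_def \<nu>.emeasure_space_1)
    also have "2 * sqdist \<nu> ((kernel_op ^^ m) \<Phi>) (\<lambda>_. 0) + 2 * ennreal (?c\<^sup>2) < \<top>"
      using sq[of m] by (simp add: square_integrable_iff_sqdist ennreal_mult_less_top)
    finally show ?thesis .
  qed
  have r: "ennreal (r m) = sqdist \<nu> ((kernel_op ^^ m) \<Phi>) (\<lambda>_. ?c)" "0 \<le> r m" for m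
    using finite[of m] by (simp_all add: r_def)
  have "(\<lambda>m. sqdist \<nu> ((kernel_op ^^ m) \<Phi>) (\<lambda>_. ?c)) \<longlonglongrightarrow> ennreal 0"
    using kernel_op_funpow_mixing[OF \<Phi>] by simp
  then have "r \<longlonglongrightarrow> 0"
    unfolding r_def[abs_def] by (rule tendsto_enn2real) simp
  then have "(\<lambda>n. ennreal ((1 / real n) * (\<Sum>m<n. r m))) \<longlonglongrightarrow> ennreal 0"
    by (intro tendsto_ennrealI cesaro_null)
  then have lim: "(\<lambda>n. ennreal ((1 / real n) * (\<Sum>m<n. r m))) \<longlonglongrightarrow> 0" by simp
  have "(\<integral>\<^sup>+x. ennreal (((1 / real n) * (\<Sum>m<n. (kernel_op ^^ m) \<Phi> x) - ?c)\<^sup>2) \<partial>\<nu>)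
      \<le> ennreal ((1 / real n) * (\<Sum>m<n. r m))" if n: "0 < n" for n
  proof -
    have "((1 / real n) * (\<Sum>m<n. (kernel_op ^^ m) \<Phi> x) - ?c)\<^sup>2
        \<le> (1 / real n) * (\<Sum>m<n. ((kernel_op ^^ m) \<Phi> x - ?c)\<^sup>2)" for x
    proof -
      have "(1 / real n) * (\<Sum>m<n. (kernel_op ^^ m) \<Phi> x) - ?c = (1 / real n) * (\<Sum>m<n. (kernel_op ^^ m) \<Phi> x - ?c)"
        using n by (simp add: sum_subtractf field_simps)
      then have "((1 / real n) * (\<Sum>m<n. (kernel_op ^^ m) \<Phi> x) - ?c)\<^sup>2
          = (1 / real n)\<^sup>2 * (\<Sum>m<n. (kernel_op ^^ m) \<Phi> x - ?c)\<^sup>2"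
        by (simp only: power_mult_distrib)
      also have "\<dots> \<le> (1 / real n)\<^sup>2 * ((\<Sum>m<n. ((kernel_op ^^ m) \<Phi> x - ?c)\<^sup>2) * real n)"
        using sum_squared_le_sum_of_squares[of "\<lambda>m. (kernel_op ^^ m) \<Phi> x - ?c" "{..<n}"]
        by (intro mult_left_mono) simp_all
      also have "\<dots> = (1 / real n) * (\<Sum>m<n. ((kernel_op ^^ m) \<Phi> x - ?c)\<^sup>2)"
        using n by (simp add: power2_eq_square)
      finally show ?thesis .
    qed
    then have "(\<integral>\<^sup>+x. ennreal (((1 / real n) * (\<Sum>m<n. (kernel_op ^^ m) \<Phi> x) - ?c)\<^sup>2) \<partial>\<nu>)
        \<le> (\<integral>\<^sup>+x. ennreal ((1 / real n) * (\<Sum>m<n. ((kernel_op ^^ m) \<Phi> x - ?c)\<^sup>2)) \<partial>\<nu>)"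
      by (intro nn_integral_mono ennreal_leI)
    also have "\<dots> = (\<integral>\<^sup>+x. ennreal (1 / real n) * (\<Sum>m<n. ennreal (((kernel_op ^^ m) \<Phi> x - ?c)\<^sup>2)) \<partial>\<nu>)"
      by (intro nn_integral_cong) (subst ennreal_mult, simp_all add: sum_nonneg sum_ennreal)
    also have "\<dots> = ennreal (1 / real n) * (\<Sum>m<n. ennreal (r m))"
      using meas by (subst nn_integral_cmult, simp) (subst nn_integral_sum, simp_all add: r sqdist_def)
    also have "\<dots> = ennreal ((1 / real n) * (\<Sum>m<n. r m))"
      using r(2) by (subst ennreal_mult) (simp_all add: sum_nonneg sum_ennreal)
    finally show ?thesis .
  qed
  then have "eventually (\<lambda>n. (\<integral>\<^sup>+x. ennreal (((1 / real n) * (\<Sum>m<n. (kernel_op ^^ m) \<Phi> x) - ?c)\<^sup>2) \<partial>\<nu>)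
      \<le> ennreal ((1 / real n) * (\<Sum>m<n. r m))) sequentially"
    by (auto simp: eventually_sequentially intro!: exI[of _ 1])
  then show "(\<lambda>n. \<integral>\<^sup>+x. ennreal (((1 / real n) * (\<Sum>m<n. (kernel_op ^^ m) \<Phi> x) - ?c)\<^sup>2) \<partial>\<nu>) \<longlonglongrightarrow> 0"
    by (intro tendsto_sandwich[OF _ _ tendsto_const lim]) simp_all
qed

end

context random_contraction
begin

text \<open>
  Integrating $P^m \Phi \to \int \Phi \, d\nu$ against $\mu$ gives
  $\int \Phi \, d\mu = \int \Phi \, d\nu$.
\<close>

lemma invariant_unique:
  assumes \<mu>: "invariant_prob S kernel_op \<mu>" and \<nu>: "invariant_prob S kernel_op \<nu>"
  shows "\<mu> = \<nu>"
proof (rule prob_eqI_bounded_lipschitz)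
  interpret \<mu>: invariant_random_contraction M S f g \<kappa> \<mu> by unfold_locales (rule \<mu>)
  interpret \<nu>: invariant_random_contraction M S f g \<kappa> \<nu> by unfold_locales (rule \<nu>)
  fix \<Phi> assume \<Phi>: "\<Phi> \<in> bounded_lipschitz S"
  note bb = bounded_lipschitz_bounded_borel[OF \<Phi>]
  obtain b where b: "\<And>x. x \<in> S \<Longrightarrow> \<bar>\<Phi> x\<bar> \<le> b"
    using \<Phi> by (auto simp: bounded_lipschitz_def)
  have "(\<lambda>m. \<integral>x. (kernel_op ^^ m) \<Phi> x \<partial>\<mu>) \<longlonglongrightarrow> (\<integral>x. (\<integral>y. \<Phi> y \<partial>\<nu>) \<partial>\<mu>)"
  proof (rule integral_dominated_convergence[where w = "\<lambda>_. b"])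
    show "(kernel_op ^^ m) \<Phi> \<in> borel_measurable \<mu>" for m
      using \<mu>.bounded_borel_integrable[OF kernel_op_funpow_bounded_borel[OF bb]]
      by (rule borel_measurable_integrable)
    show "AE x in \<mu>. (\<lambda>m. (kernel_op ^^ m) \<Phi> x) \<longlonglongrightarrow> (\<integral>y. \<Phi> y \<partial>\<nu>)"
      using \<nu>.kernel_op_funpow_tendsto[OF \<Phi>] by (intro AE_I2) (simp add: \<mu>.space_inv)
    show "AE x in \<mu>. norm ((kernel_op ^^ m) \<Phi> x) \<le> b" for m
      using kernel_op_funpow_bound[OF bb b] by (intro AE_I2) (simp add: \<mu>.space_inv)
  qed simp_all
  then show "(\<integral>x. \<Phi> x \<partial>\<mu>) = (\<integral>x. \<Phi> x \<partial>\<nu>)"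
    by (simp add: \<mu>.integral_kernel_op_funpow[OF bb] \<mu>.\<nu>.prob_space LIMSEQ_const_iff)
qed (use \<mu> \<nu> in \<open>simp_all add: invariant_prob_def\<close>)

end

section \<open>Existence of an invariant measure\<close>

lemma Cauchy_of_summable_dist:
  fixes X :: "nat \<Rightarrow> 'a::metric_space"
  assumes "summable (\<lambda>m. dist (X m) (X (Suc m)))"
  shows "Cauchy X"
  unfolding Cauchy_altdef2
proof (intro allI impI)
  fix \<epsilon> :: real assume "0 < \<epsilon>"
  then obtain K where K: "\<And>m n. K \<le> m \<Longrightarrow> norm (\<Sum>k=m..<n. dist (X k) (X (Suc k))) < \<epsilon>"
    using assms unfolding summable_Cauchy by blast
  have "dist (X n) (X K) < \<epsilon>" if "K \<le> n" for n
  proof -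
    have "dist (X n) (X K) \<le> (\<Sum>k=K..<n. dist (X k) (X (Suc k)))"
      using that
    proof (induction n rule: dec_induct)
      case (step n)
      have "dist (X (Suc n)) (X K) \<le> dist (X n) (X K) + dist (X n) (X (Suc n))"
        by (metis dist_commute dist_triangle add.commute)
      with step show ?case by simp
    qed simp
    also have "\<dots> < \<epsilon>" using K[of K n] by (simp add: sum_nonneg)
    finally show ?thesis .
  qed
  then show "\<exists>N. \<forall>n\<ge>N. dist (X n) (X N) < \<epsilon>" by blast
qed

context random_contraction
begin

interpretation seq: sequence_space M
  by unfold_locales

text \<open>
  In the \<open>m\<close>-th backward iterate the first entry of the noise sequence acts last, so that
  increasing \<open>m\<close> changes only the distant past. The forward iterates have the same laws but in
  general do not converge pathwise.
\<close>

fun backward :: "nat \<Rightarrow> (nat \<Rightarrow> 'w) \<Rightarrow> 'a" where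
  "backward 0 \<omega> = 0"
| "backward (Suc m) \<omega> = f (backward m (\<lambda>i. \<omega> (Suc i))) + g (\<omega> 0)"

lemma shift_measurable [measurable]: "(\<lambda>\<omega> i. \<omega> (Suc i)) \<in> measurable seq.S seq.S"
  by (rule measurable_PiM_single') (auto simp: space_PiM)

lemma component_measurable: "(\<lambda>\<omega>. \<omega> i) \<in> measurable seq.S M"
  by (rule measurable_component_singleton) simp

lemma g_at_measurable [measurable]: "(\<lambda>\<omega>. g (\<omega> i)) \<in> measurable seq.S N"
  by (rule measurable_compose[OF component_measurable g_measurable])

lemma backward_measurable [measurable]: "backward m \<in> measurable seq.S N"
proof (induction m)
  case 0
  show ?case using subspace_0[OF subspace_S] by (simp add: measurable_restrict_space2_iff)
next
  case (Suc m)
  have "(\<lambda>\<omega>. f (backward m (\<lambda>i. \<omega> (Suc i)))) \<in> measurable seq.S N"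
    by (rule measurable_compose[OF measurable_compose[OF shift_measurable Suc] f_measurable])
  then show ?case by (simp add: add_measurable_N)
qed

lemma shift_space: "\<omega> \<in> space seq.S \<Longrightarrow> (\<lambda>i. \<omega> (i + k)) \<in> space seq.S"
  by (auto simp: space_PiM)

text \<open>
  The two iterates apply the same \<open>m\<close> contractions, to 0 and to the first step from 0.
\<close>

lemma backward_increment:
  assumes "\<omega> \<in> space seq.S"
  shows "dist (backward m \<omega>) (backward (Suc m) \<omega>) \<le> \<kappa> ^ m * norm (f 0 + g (\<omega> m))"
  using assms
proof (induction m arbitrary: \<omega>)
  case (Suc m)
  let ?s = "\<lambda>i. \<omega> (Suc i)"
  have s: "?s \<in> space seq.S" using shift_space[OF Suc.prems, of 1] by simp
  have "dist (backward (Suc m) \<omega>) (backward (Suc (Suc m)) \<omega>) = dist (f (backward m ?s)) (f (backward (Suc m) ?s))"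
    by (simp add: dist_norm)
  also have "\<dots> \<le> \<kappa> * dist (backward m ?s) (backward (Suc m) ?s)"
    using N_space[OF backward_measurable s] by (intro lipschitz_onD[OF f_lipschitz])
  also have "\<dots> \<le> \<kappa> * (\<kappa> ^ m * norm (f 0 + g (?s m)))"
    using Suc.IH[OF s] \<kappa>_nonneg by (intro mult_left_mono)
  finally show ?case by simp
qed simp

text \<open>
  The bounds $\kappa^m \|f(0) + g(\omega_m)\|$ have a summable sequence of expectations, hence their
  sum is finite almost surely.
\<close>

lemma AE_backward_Cauchy: "AE \<omega> in seq.S. Cauchy (\<lambda>m. backward m \<omega>)"
proof -
  define c where "c = (\<integral>\<omega>. norm (f 0 + g \<omega>) \<partial>M)"
  have meas [measurable]: "(\<lambda>\<omega>. f 0 + g \<omega>) \<in> borel_measurable M"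
    using N_borel[OF g_measurable] by measurable
  have int: "integrable M (\<lambda>\<omega>. norm (f 0 + g \<omega>))"
    by (rule Bochner_Integration.integrable_bound[where f = "\<lambda>\<omega>. norm (f 0) + norm (g \<omega>)"])
      (use g_integrable in \<open>auto intro: norm_triangle_ineq\<close>)
  have c: "(\<integral>\<^sup>+\<omega>. ennreal (norm (f 0 + g \<omega>)) \<partial>M) = ennreal c" "0 \<le> c"
    unfolding c_def using int by (simp_all add: nn_integral_eq_integral)
  have gm [measurable]: "(\<lambda>\<omega>. norm (f 0 + g (\<omega> m))) \<in> borel_measurable seq.S" for m
    using measurable_compose[OF component_measurable meas, of m] by measurable
  have one: "(\<integral>\<^sup>+\<omega>. ennreal (\<kappa> ^ m * norm (f 0 + g (\<omega> m))) \<partial>seq.S) = ennreal (\<kappa> ^ m * c)" for m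
  proof -
    have "(\<integral>\<^sup>+\<omega>. ennreal (\<kappa> ^ m * norm (f 0 + g (\<omega> m))) \<partial>seq.S)
        = ennreal (\<kappa> ^ m) * (\<integral>\<^sup>+\<omega>. ennreal (norm (f 0 + g (\<omega> m))) \<partial>seq.S)"
      using \<kappa>_nonneg by (subst nn_integral_cmult[symmetric]) (auto simp: ennreal_mult)
    also have "(\<integral>\<^sup>+\<omega>. ennreal (norm (f 0 + g (\<omega> m))) \<partial>seq.S)
        = (\<integral>\<^sup>+\<omega>. ennreal (norm (f 0 + g \<omega>)) \<partial>distr seq.S M (\<lambda>\<omega>. \<omega> m))"
      by (rule nn_integral_distr[symmetric]) auto
    also have "distr seq.S M (\<lambda>\<omega>. \<omega> m) = M"
      by (rule seq.PiM_component) simp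
    finally show ?thesis using c \<kappa>_nonneg by (simp add: ennreal_mult)
  qed
  have "(\<integral>\<^sup>+\<omega>. (\<Sum>m. ennreal (\<kappa> ^ m * norm (f 0 + g (\<omega> m)))) \<partial>seq.S) = (\<Sum>m. ennreal (\<kappa> ^ m * c))"
    by (subst nn_integral_suminf) (auto simp: one)
  also have "\<dots> = ennreal (\<Sum>m. \<kappa> ^ m * c)"
    using \<kappa>_nonneg \<kappa>_less c(2) by (intro suminf_ennreal2) (auto intro!: summable_mult2 summable_geometric)
  also have "\<dots> < \<infinity>" by simp
  finally have "AE \<omega> in seq.S. (\<Sum>m. ennreal (\<kappa> ^ m * norm (f 0 + g (\<omega> m)))) \<noteq> \<infinity>"
    by (intro nn_integral_PInf_AE) auto
  then show ?thesis
  proof (rule AE_mp, intro AE_I2 impI)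
    fix \<omega> assume \<omega>: "\<omega> \<in> space seq.S"
      and "(\<Sum>m. ennreal (\<kappa> ^ m * norm (f 0 + g (\<omega> m)))) \<noteq> \<infinity>"
    then have "summable (\<lambda>m. \<kappa> ^ m * norm (f 0 + g (\<omega> m)))"
      using \<kappa>_nonneg by (intro summable_suminf_not_top) auto
    then have "summable (\<lambda>m. dist (backward m \<omega>) (backward (Suc m) \<omega>))"
      by (rule summable_comparison_test'[where N = 0]) (use backward_increment[OF \<omega>] in auto)
    then show "Cauchy (\<lambda>m. backward m \<omega>)"
      by (rule Cauchy_of_summable_dist)
  qed
qed

text \<open>
  The limit of the backward iterates; replacing them by 0 on the exceptional set makes the limit
  exist, and lie in \<open>S\<close>, for every noise sequence.
\<close>

definition stationary :: "(nat \<Rightarrow> 'w) \<Rightarrow> 'a" where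
  "stationary \<omega> = lim (\<lambda>m. if Cauchy (\<lambda>m. backward m \<omega>) then backward m \<omega> else 0)"

lemma backward_tendsto_stationary:
  "Cauchy (\<lambda>m. backward m \<omega>) \<Longrightarrow> (\<lambda>m. backward m \<omega>) \<longlonglongrightarrow> stationary \<omega>"
  unfolding stationary_def by (simp add: Cauchy_convergent convergent_LIMSEQ_iff[symmetric])

lemma stationary_measurable [measurable]: "stationary \<in> measurable seq.S N"
proof (rule measurable_restrict_space2)
  let ?Y = "\<lambda>m \<omega>. if Cauchy (\<lambda>m. backward m \<omega>) then backward m \<omega> else 0"
  have lim: "(\<lambda>m. ?Y m \<omega>) \<longlonglongrightarrow> stationary \<omega>" for \<omega>
    using backward_tendsto_stationary[of \<omega>]
    by (cases "Cauchy (\<lambda>m. backward m \<omega>)") (simp_all add: stationary_def)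
  have [measurable]: "backward m \<in> borel_measurable seq.S" for m
    by (rule N_borel) measurable
  show "stationary \<in> borel_measurable seq.S"
    by (rule borel_measurable_LIMSEQ_metric[OF _ lim]) measurable
  show "stationary \<in> space seq.S \<rightarrow> S"
  proof
    fix \<omega> assume "\<omega> \<in> space seq.S"
    then have "?Y m \<omega> \<in> S" for m
      using N_space[OF backward_measurable] subspace_0[OF subspace_S] by simp
    then show "stationary \<omega> \<in> S"
      by (rule closed_sequentially[OF closed_S _ lim])
  qed
qed

lemma stationary_case_nat:
  assumes "Cauchy (\<lambda>m. backward m \<omega>)" "\<omega> \<in> space seq.S"
  shows "stationary (case_nat s \<omega>) = f (stationary \<omega>) + g s"
proof -
  have "continuous_on S f" using f_lipschitz by (rule lipschitz_on_continuous_on)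
  then have "(\<lambda>m. f (backward m \<omega>)) \<longlonglongrightarrow> f (stationary \<omega>)"
    using backward_tendsto_stationary[OF assms(1)] N_space[OF stationary_measurable assms(2)]
    by (rule continuous_on_tendsto_compose)
      (simp add: N_space[OF backward_measurable assms(2)])
  then have "(\<lambda>m. f (backward m \<omega>) + g s) \<longlonglongrightarrow> f (stationary \<omega>) + g s"
    by (intro tendsto_add tendsto_const)
  then have "(\<lambda>m. backward (Suc m) (case_nat s \<omega>)) \<longlonglongrightarrow> f (stationary \<omega>) + g s"
    by simp
  then have lim: "(\<lambda>m. backward m (case_nat s \<omega>)) \<longlonglongrightarrow> f (stationary \<omega>) + g s"
    by (rule LIMSEQ_imp_Suc)
  then have "Cauchy (\<lambda>m. backward m (case_nat s \<omega>))" by (rule LIMSEQ_imp_Cauchy)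
  with lim backward_tendsto_stationary show ?thesis by (metis LIMSEQ_unique)
qed

text \<open>
  The law of the noise sequence is preserved when an independent copy of the noise is prepended, and
  by the lemma above this operation is one step of the chain.
\<close>

lemma invariant_stationary: "invariant_prob S kernel_op (distr seq.S N stationary)"
proof -
  let ?\<nu> = "distr seq.S N stationary"
  interpret \<nu>: prob_space ?\<nu> by (rule seq.P.prob_space_distr) measurable
  interpret R: pair_prob_space ?\<nu> M ..
  interpret MS: pair_prob_space M seq.S ..
  have step: "(\<lambda>(x, \<omega>). f x + g \<omega>) \<in> measurable (?\<nu> \<Otimes>\<^sub>M M) N"
    using step_measurable
    by (simp add: measurable_cong_sets[OF sets_pair_measure_cong[OF sets_distr refl] refl])
  have "distr (?\<nu> \<Otimes>\<^sub>M M) N (\<lambda>(x, \<omega>). f x + g \<omega>) = ?\<nu>"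
  proof (rule measure_eqI)
    fix A assume "A \<in> sets (distr (?\<nu> \<Otimes>\<^sub>M M) N (\<lambda>(x, \<omega>). f x + g \<omega>))"
    then have A [measurable]: "A \<in> sets N" by simp
    have "emeasure (distr (?\<nu> \<Otimes>\<^sub>M M) N (\<lambda>(x, \<omega>). f x + g \<omega>)) A
        = (\<integral>\<^sup>+z. indicator A z \<partial>distr (?\<nu> \<Otimes>\<^sub>M M) N (\<lambda>(x, \<omega>). f x + g \<omega>))"
      by simp
    also have "\<dots> = (\<integral>\<^sup>+z. indicator A (case z of (x, \<omega>) \<Rightarrow> f x + g \<omega>) \<partial>(?\<nu> \<Otimes>\<^sub>M M))"
      by (rule nn_integral_distr[OF step]) simp
    also have "\<dots> = (\<integral>\<^sup>+x. \<integral>\<^sup>+s. indicator A (f x + g s) \<partial>M \<partial>?\<nu>)"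
      using nn_integral_fst[OF measurable_compose[OF step borel_measurable_indicator[OF A]]] by simp
    also have "\<dots> = (\<integral>\<^sup>+\<omega>. \<integral>\<^sup>+s. indicator A (f (stationary \<omega>) + g s) \<partial>M \<partial>seq.S)"
      by (subst nn_integral_distr) auto
    \<comment> \<open>The noise of the new step becomes the first entry of the sequence.\<close>
    also have "\<dots> = (\<integral>\<^sup>+s. \<integral>\<^sup>+\<omega>. indicator A (f (stationary \<omega>) + g s) \<partial>seq.S \<partial>M)"
      by (rule MS.Fubini') measurable
    also have "\<dots> = (\<integral>\<^sup>+s. \<integral>\<^sup>+\<omega>. indicator A (stationary (case_nat s \<omega>)) \<partial>seq.S \<partial>M)"
      using AE_backward_Cauchy
      by (intro nn_integral_cong nn_integral_cong_AE) (auto simp: stationary_case_nat)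
    also have "\<dots> = (\<integral>\<^sup>+z. indicator A (stationary (case z of (s, \<omega>) \<Rightarrow> case_nat s \<omega>)) \<partial>(M \<Otimes>\<^sub>M seq.S))"
      by (subst seq.P.nn_integral_fst[symmetric]) auto
    also have "\<dots> = (\<integral>\<^sup>+\<omega>. indicator A (stationary \<omega>) \<partial>distr (M \<Otimes>\<^sub>M seq.S) seq.S (\<lambda>(s, \<omega>). case_nat s \<omega>))"
      by (rule nn_integral_distr[symmetric]) auto
    also have "\<dots> = emeasure ?\<nu> A"
      unfolding seq.PiM_iter by (subst nn_integral_indicator[symmetric], simp, subst nn_integral_distr) auto
    finally show "emeasure (distr (?\<nu> \<Otimes>\<^sub>M M) N (\<lambda>(x, \<omega>). f x + g \<omega>)) A = emeasure ?\<nu> A" .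
  qed simp
  then show ?thesis
    by (subst invariant_iff_distr[OF \<nu>.prob_space_axioms]) simp_all
qed

theorem ergodic_unique_invariant:
  "\<exists>\<nu>. invariant_prob S kernel_op \<nu> \<and> (\<forall>\<mu>. invariant_prob S kernel_op \<mu> \<longrightarrow> \<mu> = \<nu>) \<and> ergodic_wrt kernel_op \<nu>"
proof -
  interpret \<nu>: invariant_random_contraction M S f g \<kappa> "distr seq.S N stationary"
    by unfold_locales (rule invariant_stationary)
  show ?thesis
    using invariant_stationary invariant_unique \<nu>.invariant_ergodic by blast
qed

end

section \<open>The Markov property\<close>

lemma (in prob_space) indep_set_subset:
  "indep_set A B \<Longrightarrow> C \<subseteq> B \<Longrightarrow> indep_set A C"
  unfolding indep_sets2_eq by blast

context random_contraction
begin

text \<open>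
  By independence the joint law of the past and the increment \<open>h\<close> is a product measure, with the
  whole \<open>\<sigma>\<close>-algebra \<open>G\<close> kept as the first factor. Fubini's theorem then integrates out \<open>h\<close>. The
  increment need only have the law of the noise \<open>g\<close> that defines the transition operator.
\<close>

lemma real_cond_exp_step:
  assumes G: "subalgebra M G" and Y [measurable]: "Y \<in> measurable G N"
    and h [measurable]: "h \<in> measurable M N" and law: "distr M N h = distr M N g"
    and indep: "indep_set (sets G) {h -` A \<inter> space M |A. A \<in> sets N}"
    and \<Phi>: "\<Phi> \<in> bounded_borel S"
  shows "AE \<omega> in M. real_cond_exp M G (\<lambda>\<omega>. \<Phi> (f (Y \<omega>) + h \<omega>)) \<omega> = kernel_op \<Phi> (Y \<omega>)"
proof -
  interpret G: finite_measure_subalgebra M G by unfold_locales (rule G)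
  interpret \<gamma>: prob_space "distr M N h" by (rule prob_space_distr) measurable
  obtain b where b: "\<And>x. x \<in> S \<Longrightarrow> \<bar>\<Phi> x\<bar> \<le> b" and [measurable]: "\<Phi> \<in> borel_measurable N"
    using \<Phi> by (auto simp: bounded_borel_def bounded_iff)
  have space_G: "space G = space M" and sets_G: "sets G \<subseteq> sets M"
    using G by (auto simp: subalgebra_def)
  have id: "(\<lambda>\<omega>. \<omega>) \<in> measurable M G"
    using G by (rule measurable_from_subalg) simp
  have id_h: "(\<lambda>\<omega>. (\<omega>, h \<omega>)) \<in> measurable M (G \<Otimes>\<^sub>M N)"
    by (rule measurable_Pair[OF id h])
  interpret MG: prob_space "distr M G (\<lambda>\<omega>. \<omega>)" by (rule prob_space_distr[OF id])
  interpret J: pair_prob_space "distr M G (\<lambda>\<omega>. \<omega>)" "distr M N h" ..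
  have joint: "distr M G (\<lambda>\<omega>. \<omega>) \<Otimes>\<^sub>M distr M N h = distr M (G \<Otimes>\<^sub>M N) (\<lambda>\<omega>. (\<omega>, h \<omega>))"
  proof (rule pair_measure_eqI)
    fix A B assume A: "A \<in> sets (distr M G (\<lambda>\<omega>. \<omega>))" and B: "B \<in> sets (distr M N h)"
    then have AB: "A \<in> sets G" "B \<in> sets N" "A \<in> sets M" using sets_G by auto
    have A_eq: "(\<lambda>\<omega>. \<omega>) -` A \<inter> space M = A"
      using sets.sets_into_space[OF AB(3)] by auto
    have "emeasure (distr M (G \<Otimes>\<^sub>M N) (\<lambda>\<omega>. (\<omega>, h \<omega>))) (A \<times> B) = emeasure M ((\<lambda>\<omega>. (\<omega>, h \<omega>)) -` (A \<times> B) \<inter> space M)"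
      using AB by (intro emeasure_distr[OF id_h]) auto
    also have "(\<lambda>\<omega>. (\<omega>, h \<omega>)) -` (A \<times> B) \<inter> space M = A \<inter> (h -` B \<inter> space M)"
      using sets.sets_into_space[OF AB(3)] by auto
    also have "emeasure M \<dots> = emeasure M A * emeasure M (h -` B \<inter> space M)"
    proof -
      have "prob (A \<inter> (h -` B \<inter> space M)) = prob A * prob (h -` B \<inter> space M)"
        using indep AB unfolding indep_sets2_eq by blast
      then show ?thesis by (simp add: emeasure_eq_measure ennreal_mult)
    qed
    finally show "emeasure (distr M G (\<lambda>\<omega>. \<omega>)) A * emeasure (distr M N h) B
        = emeasure (distr M (G \<Otimes>\<^sub>M N) (\<lambda>\<omega>. (\<omega>, h \<omega>))) (A \<times> B)"
      using AB by (simp add: emeasure_distr[OF id AB(1)] emeasure_distr[OF h AB(2)] A_eq)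
  qed (simp_all add: MG.sigma_finite_measure_axioms \<gamma>.sigma_finite_measure_axioms cong: sets_pair_measure_cong)
  have Y_S: "Y \<omega> \<in> S" if "\<omega> \<in> space M" for \<omega>
    using N_space[OF Y] that by (simp add: space_G)
  have step_Y: "(\<lambda>(\<omega>, y). f (Y \<omega>) + y) \<in> measurable (G \<Otimes>\<^sub>M N) N"
    unfolding split_beta' by (rule add_measurable_N) measurable
  have \<Phi>_step [measurable]: "(\<lambda>(\<omega>, y). \<Phi> (f (Y \<omega>) + y)) \<in> borel_measurable (G \<Otimes>\<^sub>M N)"
    using measurable_compose[OF step_Y \<open>\<Phi> \<in> borel_measurable N\<close>] by (simp add: split_beta')
  have kernel_op_Y: "kernel_op \<Phi> (Y \<omega>) = (\<integral>y. \<Phi> (f (Y \<omega>) + y) \<partial>distr M N h)" if "\<omega> \<in> space M" for \<omega>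
  proof -
    have "(\<lambda>y. f (Y \<omega>) + y) \<in> measurable N N"
      using f_S[OF Y_S[OF that]] by (intro add_measurable_N) simp_all
    then have [measurable]: "(\<lambda>y. \<Phi> (f (Y \<omega>) + y)) \<in> borel_measurable N"
      by (rule measurable_compose) measurable
    have "(\<integral>y. \<Phi> (f (Y \<omega>) + y) \<partial>distr M N g) = (\<integral>\<omega>'. \<Phi> (f (Y \<omega>) + g \<omega>') \<partial>M)"
      by (rule integral_distr) measurable
    then show ?thesis
      by (simp only: law kernel_op_def)
  qed
  have kernel_op_meas [measurable]: "kernel_op \<Phi> \<in> borel_measurable N"
    by (rule kernel_op_measurable[OF \<open>\<Phi> \<in> borel_measurable N\<close>])
  show ?thesis
  proof (rule G.real_cond_exp_charact)
    have meas: "(\<lambda>\<omega>. \<Phi> (f (Y \<omega>) + h \<omega>)) \<in> borel_measurable M"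
      using measurable_compose[OF id_h \<Phi>_step] by simp
    then show "integrable M (\<lambda>\<omega>. \<Phi> (f (Y \<omega>) + h \<omega>))"
      using b Y_S f_S N_space[OF h] subspace_add[OF subspace_S]
      by (intro integrable_const_bound[where B = b] AE_I2) simp_all
    show kernel_op_Y_G: "(\<lambda>\<omega>. kernel_op \<Phi> (Y \<omega>)) \<in> borel_measurable G" by measurable
    show "integrable M (\<lambda>\<omega>. kernel_op \<Phi> (Y \<omega>))"
      using kernel_op_bound[OF \<Phi> b] Y_S measurable_from_subalg[OF G kernel_op_Y_G]
      by (intro integrable_const_bound[where B = b] AE_I2) simp_all
    fix A assume A [measurable]: "A \<in> sets G"
    let ?k = "\<lambda>(\<omega>, y). indicator A \<omega> * \<Phi> (f (Y \<omega>) + y)"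
    have k [measurable]: "?k \<in> borel_measurable (G \<Otimes>\<^sub>M N)" by measurable
    have k_int: "integrable (distr M G (\<lambda>\<omega>. \<omega>) \<Otimes>\<^sub>M distr M N h) ?k"
    proof (rule J.integrable_const_bound[where B = b])
      have "\<bar>indicator A \<omega> * \<Phi> (f (Y \<omega>) + y)\<bar> \<le> b" if "\<omega> \<in> space M" "y \<in> S" for \<omega> y
      proof -
        have "\<bar>\<Phi> (f (Y \<omega>) + y)\<bar> \<le> b"
          using b f_S[OF Y_S[OF that(1)]] that(2) subspace_add[OF subspace_S] by blast
        then show ?thesis by (auto simp: indicator_def)
      qed
      then show "AE z in distr M G (\<lambda>\<omega>. \<omega>) \<Otimes>\<^sub>M distr M N h. norm (?k z) \<le> b"
        by (intro AE_I2) (auto simp: space_pair_measure space_G)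
    qed simp
    have "(\<integral>\<omega>\<in>A. \<Phi> (f (Y \<omega>) + h \<omega>) \<partial>M) = (\<integral>\<omega>. ?k (\<omega>, h \<omega>) \<partial>M)"
      by (simp add: set_lebesgue_integral_def)
    also have "\<dots> = (\<integral>z. ?k z \<partial>distr M (G \<Otimes>\<^sub>M N) (\<lambda>\<omega>. (\<omega>, h \<omega>)))"
      by (rule integral_distr[OF id_h k, symmetric])
    also have "\<dots> = (\<integral>\<omega>. \<integral>y. indicator A \<omega> * \<Phi> (f (Y \<omega>) + y) \<partial>distr M N h \<partial>distr M G (\<lambda>\<omega>. \<omega>))"
      unfolding joint[symmetric] using k_int by (rule J.integral_fst[symmetric])
    also have "\<dots> = (\<integral>\<omega>. indicator A \<omega> * kernel_op \<Phi> (Y \<omega>) \<partial>distr M G (\<lambda>\<omega>. \<omega>))"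
      by (intro Bochner_Integration.integral_cong) (simp_all add: kernel_op_Y space_G)
    also have "\<dots> = (\<integral>\<omega>. indicator A \<omega> * kernel_op \<Phi> (Y \<omega>) \<partial>M)"
      by (rule integral_distr[OF id]) measurable
    finally show "(\<integral>\<omega>\<in>A. \<Phi> (f (Y \<omega>) + h \<omega>) \<partial>M) = (\<integral>\<omega>\<in>A. kernel_op \<Phi> (Y \<omega>) \<partial>M)"
      by (simp add: set_lebesgue_integral_def)
  qed
qed

end

section \<open>Galerkin spaces and the semigroup\<close>

lemma orthonormal_basis_inner: "orthonormal_basis e \<Longrightarrow> e i \<bullet> e j = (if i = j then 1 else 0)"
  by (simp add: orthonormal_basis_def)

lemma galerkin_comb_mem: "(\<Sum>i<n. a i *\<^sub>R e i) \<in> galerkin_space e n"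
  unfolding galerkin_space_def by (intro span_sum span_scale span_base) auto

lemma inner_galerkin_comb:
  assumes "orthonormal_basis e" "j < n"
  shows "e j \<bullet> (\<Sum>i<n. a i *\<^sub>R e i) = a j"
  using assms by (simp add: inner_sum_right orthonormal_basis_inner if_distrib cong: if_cong)

lemma norm_galerkin_comb:
  assumes "orthonormal_basis e"
  shows "(norm (\<Sum>i<n. a i *\<^sub>R e i))\<^sup>2 = (\<Sum>i<n. (a i)\<^sup>2)"
proof -
  have "(norm (\<Sum>i<n. a i *\<^sub>R e i))\<^sup>2 = (\<Sum>j<n. a j * (e j \<bullet> (\<Sum>i<n. a i *\<^sub>R e i)))"
    by (simp only: power2_norm_eq_inner inner_sum_left inner_scaleR_left)
  also have "\<dots> = (\<Sum>j<n. (a j)\<^sup>2)"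
    using assms by (intro sum.cong) (simp_all add: inner_galerkin_comb power2_eq_square)
  finally show ?thesis .
qed

lemma bessel_inequality:
  assumes "orthonormal_basis e"
  shows "(\<Sum>i<n. (e i \<bullet> x)\<^sup>2) \<le> (norm x)\<^sup>2"
proof -
  let ?p = "\<Sum>i<n. (e i \<bullet> x) *\<^sub>R e i"
  have "?p \<bullet> x = (\<Sum>i<n. (e i \<bullet> x)\<^sup>2)"
    by (simp add: inner_sum_left power2_eq_square)
  moreover have "(norm ?p)\<^sup>2 = (\<Sum>i<n. (e i \<bullet> x)\<^sup>2)"
    using assms by (rule norm_galerkin_comb)
  moreover have "0 \<le> (norm (x - ?p))\<^sup>2" by simp
  then have "0 \<le> (norm x)\<^sup>2 - 2 * (?p \<bullet> x) + (norm ?p)\<^sup>2"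
    by (simp add: power2_norm_eq_inner inner_diff_left inner_diff_right inner_commute)
  ultimately show ?thesis by simp
qed

lemma galerkin_proj_comb:
  assumes "orthonormal_basis e"
  shows "galerkin_proj e n (\<Sum>i<n. a i *\<^sub>R e i) = (\<Sum>i<n. a i *\<^sub>R e i)"
  unfolding galerkin_proj_def using assms by (intro sum.cong) (simp_all add: inner_galerkin_comb)

lemma galerkin_proj_mem: "galerkin_proj e n x \<in> galerkin_space e n"
  unfolding galerkin_proj_def by (rule galerkin_comb_mem)

lemma galerkin_proj_id:
  assumes "orthonormal_basis e" "x \<in> galerkin_space e n"
  shows "galerkin_proj e n x = x"
proof -
  obtain c where "x = (\<Sum>v\<in>e ` {..<n}. c v *\<^sub>R v)"
    using assms(2) unfolding galerkin_space_def by (auto simp: span_finite)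
  moreover have "inj_on e {..<n}"
    using assms(1) by (intro inj_onI) (metis orthonormal_basis_inner zero_neq_one)
  ultimately have "x = (\<Sum>i<n. c (e i) *\<^sub>R e i)"
    by (simp add: sum.reindex)
  then show ?thesis using galerkin_proj_comb[OF assms(1), of n "\<lambda>i. c (e i)"] by simp
qed

text \<open>
  The Galerkin space is the set of fixed points of the continuous map $P_n$.
\<close>

lemma closed_galerkin_space:
  assumes "orthonormal_basis e"
  shows "closed (galerkin_space e n)"
proof -
  have eq: "galerkin_space e n = {x. galerkin_proj e n x = x}"
  proof (rule set_eqI)
    show "x \<in> galerkin_space e n \<longleftrightarrow> x \<in> {x. galerkin_proj e n x = x}" for x
      using galerkin_proj_id[OF assms, of x n] galerkin_proj_mem[of e n x] by (cases "galerkin_proj e n x = x") auto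
  qed
  have "continuous_on UNIV (galerkin_proj e n)"
    unfolding galerkin_proj_def by (intro continuous_on_sum continuous_on_scaleR continuous_on_inner continuous_on_const continuous_on_id)
  then show ?thesis
    unfolding eq by (intro closed_Collect_eq continuous_on_id)
qed

lemma galerkin_comb_measurable:
  fixes e :: "nat \<Rightarrow> 'a::{real_inner, polish_space}"
  assumes "{..<n} \<subseteq> I"
  shows "(\<lambda>v. \<Sum>i<n. (c i * v i) *\<^sub>R e i) \<in> measurable (\<Pi>\<^sub>M i\<in>I. borel) (restrict_space borel (galerkin_space e n))"
proof (rule measurable_restrict_space2)
  show "(\<lambda>v. \<Sum>i<n. (c i * v i) *\<^sub>R e i) \<in> borel_measurable (\<Pi>\<^sub>M i\<in>I. borel)"
  proof (rule borel_measurable_sum)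
    fix i assume "i \<in> {..<n}"
    with assms have "(\<lambda>v. v i) \<in> borel_measurable (\<Pi>\<^sub>M i\<in>I. (borel :: real measure))"
      by (intro measurable_component_singleton) auto
    then show "(\<lambda>v. (c i * v i) *\<^sub>R e i) \<in> borel_measurable (\<Pi>\<^sub>M i\<in>I. borel)"
      by (intro borel_measurable_scaleR borel_measurable_times borel_measurable_const)
  qed
qed (simp add: galerkin_comb_mem)

lemma densely_defined_linear_sum:
  assumes "densely_defined_linear D A" "finite I" "\<And>i. i \<in> I \<Longrightarrow> v i \<in> D"
  shows "(\<Sum>i\<in>I. a i *\<^sub>R v i) \<in> D \<and> A (\<Sum>i\<in>I. a i *\<^sub>R v i) = (\<Sum>i\<in>I. a i *\<^sub>R A (v i))"
  using assms(2,3)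
proof (induction rule: finite_induct)
  case empty
  have "0 \<in> D"
    using assms(1) subspace_0 by (auto simp: densely_defined_linear_def)
  moreover from this have "A (0 *\<^sub>R 0) = 0 *\<^sub>R A 0"
    using assms(1) unfolding densely_defined_linear_def by blast
  then have "A 0 = 0" by simp
  ultimately show ?case by simp
next
  case (insert i I)
  have D: "subspace D" and add: "\<And>x y. x \<in> D \<Longrightarrow> y \<in> D \<Longrightarrow> A (x + y) = A x + A y"
    and scale: "\<And>c x. x \<in> D \<Longrightarrow> A (c *\<^sub>R x) = c *\<^sub>R A x"
    using assms(1) by (auto simp: densely_defined_linear_def)
  have "a i *\<^sub>R v i \<in> D" using insert.prems D by (auto intro: subspace_scale)
  with insert add scale D show ?case by (auto intro: subspace_add)
qed

text \<open>
  The operator $A P_n$ is diagonal on $H_n$, so the exponential series can be summed in each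
  coordinate.
\<close>

lemma galerkin_semigroup_comb:
  fixes e :: "nat \<Rightarrow> 'a::real_inner"
  assumes A: "densely_defined_linear D A" and basis: "orthonormal_basis e"
    and eigen: "\<And>i. e i \<in> D" "\<And>i. - A (e i) = lam i *\<^sub>R e i"
  shows "galerkin_semigroup A e n t (\<Sum>i<n. a i *\<^sub>R e i) = (\<Sum>i<n. (exp (- lam i * t) * a i) *\<^sub>R e i)"
proof -
  have Ae: "A (e i) = (- lam i) *\<^sub>R e i" for i
    using eigen(2)[of i] by (metis minus_minus scaleR_minus_left)
  have pow: "((\<lambda>y. A (galerkin_proj e n y)) ^^ k) (\<Sum>i<n. a i *\<^sub>R e i) = (\<Sum>i<n. ((- lam i) ^ k * a i) *\<^sub>R e i)" for k
  proof (induction k)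
    case (Suc k)
    have "((\<lambda>y. A (galerkin_proj e n y)) ^^ Suc k) (\<Sum>i<n. a i *\<^sub>R e i)
        = A (\<Sum>i<n. ((- lam i) ^ k * a i) *\<^sub>R e i)"
      by (simp only: funpow.simps comp_apply Suc galerkin_proj_comb[OF basis])
    also have "\<dots> = (\<Sum>i<n. ((- lam i) ^ k * a i) *\<^sub>R A (e i))"
      using densely_defined_linear_sum[OF A, of "{..<n}" e "\<lambda>i. (- lam i) ^ k * a i"] eigen(1) by simp
    also have "\<dots> = (\<Sum>i<n. ((- lam i) ^ Suc k * a i) *\<^sub>R e i)"
      by (intro sum.cong refl) (simp only: Ae scaleR_scaleR, simp add: mult_ac)
    finally show ?case .
  qed simp
  have "(\<lambda>k. (t ^ k / fact k) *\<^sub>R (\<Sum>i<n. ((- lam i) ^ k * a i) *\<^sub>R e i)) sums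
      (\<Sum>i<n. (exp (- lam i * t) * a i) *\<^sub>R e i)"
  proof -
    have "(\<lambda>k. (t ^ k / fact k * ((- lam i) ^ k * a i)) *\<^sub>R e i) sums ((exp (- lam i * t) * a i) *\<^sub>R e i)" for i
    proof -
      have "(\<lambda>k. (- lam i * t) ^ k /\<^sub>R fact k * a i) sums (exp (- lam i * t) * a i)"
        by (intro sums_mult2 exp_converges)
      moreover have "(- lam i * t) ^ k /\<^sub>R fact k * a i = t ^ k / fact k * ((- lam i) ^ k * a i)" for k
        unfolding power_mult_distrib by (simp add: field_simps)
      ultimately have "(\<lambda>k. t ^ k / fact k * ((- lam i) ^ k * a i)) sums (exp (- lam i * t) * a i)"
        by simp
      then show ?thesis by (rule sums_scaleR_left)
    qed
    then have "(\<lambda>k. \<Sum>i<n. (t ^ k / fact k * ((- lam i) ^ k * a i)) *\<^sub>R e i) sums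
        (\<Sum>i<n. (exp (- lam i * t) * a i) *\<^sub>R e i)"
      by (intro sums_sum) simp
    then show ?thesis by (simp only: scaleR_sum_right scaleR_scaleR)
  qed
  then show ?thesis
    unfolding galerkin_semigroup_def pow by (rule sums_unique[symmetric])
qed

section \<open>Contractivity of the drift\<close>

lemma bounded_derivative_lipschitz:
  fixes F :: "'a::real_normed_vector \<Rightarrow> 'a" and F' :: "'a \<Rightarrow> 'a \<Rightarrow>\<^sub>L 'a"
  assumes "\<And>x. (F has_derivative blinfun_apply (F' x)) (at x)"
    and "\<And>x y. norm (F' x y) \<le> L * norm y" "0 \<le> L"
  shows "norm (F x - F y) \<le> L * norm (x - y)"
proof (rule differentiable_bound[where S = UNIV])
  show "onorm (blinfun_apply (F' x)) \<le> L" for x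
    using assms(2,3) by (intro onorm_bound)
qed (use assms(1) in auto)

text \<open>
  Expanding the square gives the factor $1 + 2 \tau K + \tau^2 L^2$. The bound of this factor by an exponential
  combines with the exponential decay of the semigroup into a single exponent.
\<close>

lemma one_sided_lipschitz_step:
  fixes d \<Delta> :: "'a::real_inner"
  assumes "d \<bullet> \<Delta> \<le> K * (norm d)\<^sup>2" "norm \<Delta> \<le> L * norm d" "0 \<le> \<tau>"
  shows "(norm (d + \<tau> *\<^sub>R \<Delta>))\<^sup>2 \<le> exp (2 * \<tau> * K + \<tau>\<^sup>2 * L\<^sup>2) * (norm d)\<^sup>2"
proof -
  have "(norm (d + \<tau> *\<^sub>R \<Delta>))\<^sup>2 = (norm d)\<^sup>2 + 2 * \<tau> * (d \<bullet> \<Delta>) + \<tau>\<^sup>2 * (norm \<Delta>)\<^sup>2"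
    unfolding power2_norm_eq_inner
    by (simp add: inner_add_left inner_add_right inner_commute[of \<Delta> d] power2_eq_square algebra_simps)
  also have "\<dots> \<le> (norm d)\<^sup>2 + 2 * \<tau> * (K * (norm d)\<^sup>2) + \<tau>\<^sup>2 * (L * norm d)\<^sup>2"
    using assms by (intro add_mono mult_left_mono power_mono order_refl) simp_all
  also have "\<dots> = (1 + (2 * \<tau> * K + \<tau>\<^sup>2 * L\<^sup>2)) * (norm d)\<^sup>2"
    by (simp add: power_mult_distrib algebra_simps)
  also have "\<dots> \<le> exp (2 * \<tau> * K + \<tau>\<^sup>2 * L\<^sup>2) * (norm d)\<^sup>2"
    by (intro mult_right_mono exp_ge_add_one_self) simp
  finally show ?thesis .
qed

text \<open>
  On $H_n$ the drift is $x \mapsto E_n(\tau) P_n (x + \tau F(x))$. Its coordinates carry the factors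
  $e^{-\lambda_i \tau} \le e^{-\lambda_1 \tau}$, and Bessel's inequality removes the projection, so the
  one-sided condition for \<open>F\<close> on the full space applies.
\<close>

lemma expo_euler_drift_lipschitz:
  assumes A: "densely_defined_linear D A" and basis: "orthonormal_basis e"
    and eigen: "\<And>i. e i \<in> D" "\<And>i. - A (e i) = lam i *\<^sub>R e i" and lam: "mono lam"
    and F: "\<And>x y. norm (F x - F y) \<le> L * norm (x - y)"
    and one_sided: "\<And>x y. (x - y) \<bullet> (F x - F y) \<le> K * (norm (x - y))\<^sup>2"
    and \<tau>: "0 \<le> \<tau>"
  shows "(exp (\<tau> * K + \<tau>\<^sup>2 * L\<^sup>2 / 2 - lam 0 * \<tau>))-lipschitz_on (galerkin_space e n)
    (\<lambda>x. galerkin_semigroup A e n \<tau> x + \<tau> *\<^sub>R galerkin_semigroup A e n \<tau> (galerkin_proj e n (F x)))"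
    (is "?\<kappa>-lipschitz_on _ ?f")
proof (rule lipschitz_onI)
  have f_eq: "?f x = (\<Sum>i<n. (exp (- lam i * \<tau>) * (e i \<bullet> (x + \<tau> *\<^sub>R F x))) *\<^sub>R e i)"
    if "x \<in> galerkin_space e n" for x
  proof -
    have "galerkin_semigroup A e n \<tau> (galerkin_proj e n y) = (\<Sum>i<n. (exp (- lam i * \<tau>) * (e i \<bullet> y)) *\<^sub>R e i)" for y
      unfolding galerkin_proj_def by (rule galerkin_semigroup_comb[OF A basis eigen])
    note this[of x, unfolded galerkin_proj_id[OF basis that]] this[of "F x"]
    then show ?thesis
      by (simp add: inner_add_right distrib_left scaleR_add_left sum.distrib scaleR_sum_right mult_ac)
  qed
  fix x y assume x: "x \<in> galerkin_space e n" and y: "y \<in> galerkin_space e n"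
  let ?d = "x - y" and ?u = "(x - y) + \<tau> *\<^sub>R (F x - F y)"
  have "?f x - ?f y = (\<Sum>i<n. (exp (- lam i * \<tau>) * (e i \<bullet> ?u)) *\<^sub>R e i)"
    unfolding f_eq[OF x] f_eq[OF y] sum_subtractf[symmetric]
    by (intro sum.cong refl) (simp add: inner_add_right inner_diff_right algebra_simps)
  then have "(norm (?f x - ?f y))\<^sup>2 = (\<Sum>i<n. (exp (- lam i * \<tau>) * (e i \<bullet> ?u))\<^sup>2)"
    using norm_galerkin_comb[OF basis] by simp
  also have "\<dots> \<le> (\<Sum>i<n. (exp (- lam 0 * \<tau>))\<^sup>2 * (e i \<bullet> ?u)\<^sup>2)"
  proof (rule sum_mono)
    fix i
    have "lam 0 \<le> lam i" using lam by (rule monoD) simp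
    then have "exp (- lam i * \<tau>) \<le> exp (- lam 0 * \<tau>)" using \<tau> by (simp add: mult_right_mono)
    then show "(exp (- lam i * \<tau>) * (e i \<bullet> ?u))\<^sup>2 \<le> (exp (- lam 0 * \<tau>))\<^sup>2 * (e i \<bullet> ?u)\<^sup>2"
      unfolding power_mult_distrib by (intro mult_right_mono power_mono) simp_all
  qed
  also have "\<dots> \<le> (exp (- lam 0 * \<tau>))\<^sup>2 * (norm ?u)\<^sup>2"
    using bessel_inequality[OF basis] by (simp only: sum_distrib_left[symmetric]) (intro mult_left_mono, simp_all)
  also have "\<dots> \<le> (exp (- lam 0 * \<tau>))\<^sup>2 * (exp (2 * \<tau> * K + \<tau>\<^sup>2 * L\<^sup>2) * (norm ?d)\<^sup>2)"
    using one_sided_lipschitz_step[OF one_sided F \<tau>] by (rule mult_left_mono) simp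
  also have "\<dots> = (?\<kappa> * norm ?d)\<^sup>2"
  proof -
    have "(exp (- lam 0 * \<tau>))\<^sup>2 * exp (2 * \<tau> * K + \<tau>\<^sup>2 * L\<^sup>2) = ?\<kappa>\<^sup>2"
      unfolding power2_eq_square mult_exp_exp by (rule arg_cong[where f = exp]) simp
    then show ?thesis by (simp only: power_mult_distrib mult.assoc[symmetric])
  qed
  finally have "norm (?f x - ?f y) \<le> ?\<kappa> * norm ?d"
    by (rule power2_le_imp_le) simp
  then show "dist (?f x) (?f y) \<le> ?\<kappa> * dist x y"
    by (simp add: dist_norm)
qed simp

section \<open>Increments of the noise\<close>

lemma galerkin_noise_increment:
  assumes A: "densely_defined_linear D A" and basis: "orthonormal_basis e"
    and eigen: "\<And>i. e i \<in> D" "\<And>i. - A (e i) = lam i *\<^sub>R e i"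
  shows "galerkin_semigroup A e n \<tau> (galerkin_noise e q B n t \<omega> - galerkin_noise e q B n s \<omega>)
    = (\<Sum>i<n. (exp (- lam i * \<tau>) * sqrt (q i) * (B i t \<omega> - B i s \<omega>)) *\<^sub>R e i)"
proof -
  have "galerkin_noise e q B n t \<omega> - galerkin_noise e q B n s \<omega>
      = (\<Sum>i<n. (sqrt (q i) * (B i t \<omega> - B i s \<omega>)) *\<^sub>R e i)"
    unfolding galerkin_noise_def sum_subtractf[symmetric]
    by (intro sum.cong refl) (simp add: right_diff_distrib scaleR_left_diff_distrib)
  then show ?thesis
    by (simp add: galerkin_semigroup_comb[OF A basis eigen] mult.assoc)
qed

lemma wiener_coordinate_measurable:
  assumes "wiener_coordinates M Ft B" "0 \<le> s"
  shows "B i s \<in> borel_measurable M"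
  using assms by (simp add: wiener_coordinates_def brownian_motion_def)

text \<open>
  The coordinates are independent and their increments are centred Gaussian with variance equal to
  the length of the time interval, so the joint law depends on this length only.
\<close>

lemma wiener_increments_same_law:
  assumes M: "prob_space M" and W: "wiener_coordinates M Ft B"
    and t: "0 \<le> s" "s < t" "0 \<le> s'" "s' < t'" "t - s = t' - s'" and I: "I \<noteq> {}"
  shows "distr M (\<Pi>\<^sub>M i\<in>I. borel) (\<lambda>\<omega>. \<lambda>i\<in>I. B i t \<omega> - B i s \<omega>)
    = distr M (\<Pi>\<^sub>M i\<in>I. borel) (\<lambda>\<omega>. \<lambda>i\<in>I. B i t' \<omega> - B i s' \<omega>)"
proof -
  interpret prob_space M by fact
  have law: "distr M (\<Pi>\<^sub>M i\<in>I. borel) (\<lambda>\<omega>. \<lambda>i\<in>I. B i t \<omega> - B i s \<omega>)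
      = (\<Pi>\<^sub>M i\<in>I. density lborel (normal_density 0 (sqrt (t - s))))"
    if st: "0 \<le> s" "s < t" for s t
  proof -
    have meas: "(\<lambda>\<omega>. B i t \<omega> - B i s \<omega>) \<in> borel_measurable M" for i
      using wiener_coordinate_measurable[OF W] st by (intro borel_measurable_diff) simp_all
    have "indep_vars (\<lambda>_. \<Pi>\<^sub>M t\<in>{0..}. borel) (\<lambda>i \<omega>. \<lambda>t\<in>{0..}. B i t \<omega>) UNIV"
      using W by (simp add: wiener_coordinates_def)
    then have "indep_vars (\<lambda>_. borel) (\<lambda>i \<omega>. (\<lambda>p. p t - p s) (\<lambda>t\<in>{0..}. B i t \<omega>)) UNIV"
    proof (rule indep_vars_compose2)
      have "(\<lambda>p. p t) \<in> measurable (\<Pi>\<^sub>M t\<in>{0..}. borel) borel" "(\<lambda>p. p s) \<in> measurable (\<Pi>\<^sub>M t\<in>{0..}. borel) borel"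
        using st by (auto intro!: measurable_component_singleton)
      then show "(\<lambda>p. p t - p s) \<in> borel_measurable (\<Pi>\<^sub>M t\<in>{0::real..}. (borel :: real measure))"
        by (rule borel_measurable_diff)
    qed
    then have "indep_vars (\<lambda>_. borel) (\<lambda>i \<omega>. B i t \<omega> - B i s \<omega>) UNIV"
      using st by simp
    then have "indep_vars (\<lambda>_. borel) (\<lambda>i \<omega>. B i t \<omega> - B i s \<omega>) I"
      by (rule indep_vars_subset) simp
    then have "distr M (\<Pi>\<^sub>M i\<in>I. borel) (\<lambda>\<omega>. \<lambda>i\<in>I. B i t \<omega> - B i s \<omega>)
        = (\<Pi>\<^sub>M i\<in>I. distr M borel (\<lambda>\<omega>. B i t \<omega> - B i s \<omega>))"
      by (subst (asm) indep_vars_iff_distr_eq_PiM'[OF I meas])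
    also have "\<dots> = (\<Pi>\<^sub>M i\<in>I. density lborel (normal_density 0 (sqrt (t - s))))"
    proof (rule PiM_cong)
      fix i
      have "distributed M lborel (\<lambda>\<omega>. B i t \<omega> - B i s \<omega>) (normal_density 0 (sqrt (t - s)))"
        using W st by (simp add: wiener_coordinates_def brownian_motion_def)
      from distributed_distr_eq_density[OF this]
      show "distr M borel (\<lambda>\<omega>. B i t \<omega> - B i s \<omega>) = density lborel (normal_density 0 (sqrt (t - s)))"
        by (simp cong: distr_cong)
    qed simp
    finally show ?thesis .
  qed
  show ?thesis unfolding law[OF t(1,2)] law[OF t(3,4)] t(5) ..
qed

lemma wiener_increment_integrable:
  assumes "prob_space M" "wiener_coordinates M Ft B" "0 \<le> s" "s < t"
  shows "integrable M (\<lambda>\<omega>. B i t \<omega> - B i s \<omega>)"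
proof -
  interpret prob_space M by fact
  have d: "distributed M lborel (\<lambda>\<omega>. B i t \<omega> - B i s \<omega>) (normal_density 0 (sqrt (t - s)))"
    using assms by (simp add: wiener_coordinates_def brownian_motion_def)
  have "integrable lborel (\<lambda>x. normal_density 0 (sqrt (t - s)) x * x)"
    using normal_moment_nz_1[of "sqrt (t - s)" 0] assms(4) by (auto intro: integrable.intros)
  then show ?thesis
    using distributed_integrable[OF d, of "\<lambda>x. x"] by simp
qed

section \<open>Ergodicity of the exponential Euler scheme\<close>

theorem theorem4p7:
  fixes D :: "'a::{real_inner, polish_space} set"
    and A Q F :: "'a \<Rightarrow> 'a"
    and e :: "nat \<Rightarrow> 'a" and lam q :: "nat \<Rightarrow> real"
    and M :: "'w measure" and Ft :: "real \<Rightarrow> 'w measure"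
    and B :: "nat \<Rightarrow> real \<Rightarrow> 'w \<Rightarrow> real"
    and X0 :: 'a
    and F' :: "'a \<Rightarrow> 'a \<Rightarrow>\<^sub>L 'a" and F'' :: "'a \<Rightarrow> 'a \<Rightarrow>\<^sub>L 'a \<Rightarrow>\<^sub>L 'a"
    and \<beta> L_F L \<delta> \<eta> \<tau> \<tau>0 :: real and n :: nat
    and Z :: "'a \<Rightarrow> nat \<Rightarrow> 'w \<Rightarrow> 'a" and P :: "('a \<Rightarrow> real) \<Rightarrow> 'a \<Rightarrow> real"
  assumes A: "densely_defined_linear D A" "self_adjoint_on D A" "negative_definite_on D A"
      "has_compact_inverse D A"
    and basis: "orthonormal_basis e"
    and eigen: "\<And>i. e i \<in> D" "\<And>i. - A (e i) = lam i *\<^sub>R e i"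
    and lam: "0 < lam 0" "mono lam" "filterlim lam at_top sequentially"
    and Q: "bounded_linear Q" "self_adjoint_on UNIV Q" "positive_definite_on UNIV Q"
      "commutes_with D A Q" "\<And>i. Q (e i) = q i *\<^sub>R e i"
    and M: "prob_space M" "filtration_on M Ft" "wiener_coordinates M Ft B"
    and beta: "0 < \<beta>" "\<beta> \<le> 1"
    and HS: "hilbert_schmidt (\<lambda>x. frac_pow e lam ((\<beta> - 1) / 2) (spectral_op e (\<lambda>i. sqrt (q i)) x))"
    and X0: "X0 \<in> Hdot e lam (max (2 * \<beta>) 1)"
    and F': "\<And>x. (F has_derivative blinfun_apply (F' x)) (at x)"
    and F'': "\<And>x. (F' has_derivative blinfun_apply (F'' x)) (at x)"
    and one_sided: "\<And>x y. (x - y) \<bullet> (F x - F y) \<le> L_F * (norm (x - y))\<^sup>2" "L_F < lam 0"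
    and params: "0 < L" "1 \<le> \<delta>" "\<delta> < 2" "0 \<le> \<eta>" "\<eta> < 1"
    and F'_bound: "\<And>x y. norm (F' x y) \<le> L * norm y"
    and F'_smooth: "\<And>x y. x \<in> Hdot e lam 1 \<Longrightarrow>
      norm (frac_pow e lam (- \<delta> / 2) (F' x y))
        \<le> L * (1 + Hdot_norm e lam 1 x) * Hdot_norm e lam (- 1) y"
    and F''_bound: "\<And>x y z. norm (frac_pow e lam (- \<eta>) (F'' x y z)) \<le> L * norm y * norm z"
    and tau: "0 < \<tau>" "\<tau> < \<tau>0" "\<tau>0 \<le> (lam 0 - L_F) / (4 * L\<^sup>2)"
    and n: "1 \<le> n"
    and Z: "Z = expo_euler A e q B F n \<tau>"
    and P: "P = transition_op M Z"
  shows "markov_chain_on M (\<lambda>m. Ft (real m * \<tau>)) (galerkin_space e n) P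
           (Z (galerkin_proj e n X0))
    \<and> (\<exists>\<nu>. invariant_prob (galerkin_space e n) P \<nu>
         \<and> (\<forall>\<mu>. invariant_prob (galerkin_space e n) P \<mu> \<longrightarrow> \<mu> = \<nu>)
         \<and> ergodic_wrt P \<nu>)"
proof -
  interpret prob_space M by fact
  let ?S = "galerkin_space e n"
  let ?N = "restrict_space borel ?S"
  let ?E = "galerkin_semigroup A e n \<tau>"
  define f where "f x = ?E x + \<tau> *\<^sub>R ?E (galerkin_proj e n (F x))" for x
  define g where "g m \<omega> = ?E (galerkin_noise e q B n (real (Suc m) * \<tau>) \<omega> - galerkin_noise e q B n (real m * \<tau>) \<omega>)"
    for m \<omega>
  define incr where "incr m \<omega> i = B i (real (Suc m) * \<tau>) \<omega> - B i (real m * \<tau>) \<omega>" for m \<omega> i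
  define \<psi> where "\<psi> v = (\<Sum>i<n. (exp (- lam i * \<tau>) * sqrt (q i) * v i) *\<^sub>R e i)" for v
  define \<kappa> where "\<kappa> = exp (\<tau> * L_F + \<tau>\<^sup>2 * L\<^sup>2 / 2 - lam 0 * \<tau>)"
  have g_eq: "g m \<omega> = \<psi> (incr m \<omega>)" for m \<omega>
    unfolding g_def \<psi>_def incr_def by (rule galerkin_noise_increment[OF A(1) basis eigen])
  have \<psi>_meas: "\<psi> \<in> measurable (\<Pi>\<^sub>M i\<in>I. borel) ?N" if "{..<n} \<subseteq> I" for I
    unfolding \<psi>_def[abs_def] using that by (rule galerkin_comb_measurable)
  have times: "0 \<le> real m * \<tau>" "real m * \<tau> < real (Suc m) * \<tau>"
    "real (Suc m) * \<tau> - real m * \<tau> = \<tau>" for m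
    using tau(1) by (simp_all add: algebra_simps)
  have incr_meas: "(\<lambda>\<omega>. incr m \<omega> i) \<in> borel_measurable M" for m i
    unfolding incr_def
    using wiener_coordinate_measurable[OF M(3)] times[of m] times(1)[of "Suc m"]
    by (intro borel_measurable_diff) simp_all
  have g_meas: "g m \<in> measurable M ?N" for m
  proof -
    have "(\<lambda>\<omega>. incr m \<omega>) \<in> measurable M (\<Pi>\<^sub>M i\<in>UNIV. borel)"
      using incr_meas by (intro measurable_PiM_single') (auto simp: incr_def)
    then have "(\<lambda>\<omega>. \<psi> (incr m \<omega>)) \<in> measurable M ?N"
      by (rule measurable_compose) (rule \<psi>_meas, simp)
    then show ?thesis by (simp add: g_eq[abs_def])
  qed
  have F_lip: "norm (F x - F y) \<le> L * norm (x - y)" for x y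
    using F' F'_bound params(1) by (intro bounded_derivative_lipschitz) simp_all
  have f_lip: "\<kappa>-lipschitz_on ?S f"
    unfolding \<kappa>_def f_def[abs_def] using tau(1)
    by (intro expo_euler_drift_lipschitz[OF A(1) basis eigen lam(2) F_lip one_sided(1)]) simp
  \<comment> \<open>The step size bound makes the term of the exponent that is quadratic in \<open>\<tau>\<close> smaller than the
    absolute value of the linear term, which is negative.\<close>
  have "\<kappa> < 1"
  proof -
    have "\<tau> < (lam 0 - L_F) / (4 * L\<^sup>2)" using tau by simp
    then have "\<tau> * L\<^sup>2 < (lam 0 - L_F) / 4" using params(1) by (simp add: field_simps)
    moreover have "0 \<le> \<tau> * L\<^sup>2" using tau(1) by simp
    ultimately have "\<tau> * L\<^sup>2 / 2 < lam 0 - L_F"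
      using one_sided(2) by argo
    then have "\<tau> * (\<tau> * L\<^sup>2 / 2) < \<tau> * (lam 0 - L_F)" using tau(1) by (rule mult_strict_left_mono)
    then have "\<tau> * L_F + \<tau>\<^sup>2 * L\<^sup>2 / 2 - lam 0 * \<tau> < 0"
      by (simp add: power2_eq_square algebra_simps)
    then show ?thesis by (simp add: \<kappa>_def)
  qed
  have f_S: "f x \<in> ?S" if "x \<in> ?S" for x
  proof -
    have E: "?E (galerkin_proj e n y) \<in> ?S" for y
      unfolding galerkin_proj_def galerkin_semigroup_comb[OF A(1) basis eigen] by (rule galerkin_comb_mem)
    then have "?E x \<in> ?S" by (metis galerkin_proj_id[OF basis that])
    then show ?thesis
      unfolding f_def using E[of "F x"] by (simp add: galerkin_space_def span_add span_scale)
  qed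
  have g_int: "integrable M (\<lambda>\<omega>. norm (g 0 \<omega>))"
  proof (rule Bochner_Integration.integrable_bound)
    let ?b = "\<lambda>\<omega>. \<Sum>i<n. \<bar>exp (- lam i * \<tau>) * sqrt (q i)\<bar> * \<bar>incr 0 \<omega> i\<bar> * norm (e i)"
    have "integrable M (\<lambda>\<omega>. incr 0 \<omega> i)" for i
      unfolding incr_def using times[of 0] by (intro wiener_increment_integrable[OF M(1,3)])
    then show "integrable M ?b"
      by (intro Bochner_Integration.integrable_sum integrable_mult_left integrable_mult_right integrable_abs)
    show "(\<lambda>\<omega>. norm (g 0 \<omega>)) \<in> borel_measurable M"
      using g_meas[of 0]
      by (intro measurable_compose[OF _ borel_measurable_norm]) (simp add: measurable_restrict_space2_iff)
    have "norm (g 0 \<omega>) \<le> ?b \<omega>" for \<omega>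
      unfolding g_eq \<psi>_def by (rule order_trans[OF norm_sum]) (simp add: abs_mult)
    then have "norm (norm (g 0 \<omega>)) \<le> norm (?b \<omega>)" for \<omega>
      using abs_ge_self[of "?b \<omega>"] unfolding real_norm_def abs_norm_cancel by (rule order_trans)
    then show "AE \<omega> in M. norm (norm (g 0 \<omega>)) \<le> norm (?b \<omega>)" by simp
  qed
  interpret chain: random_contraction M ?S f "g 0" \<kappa>
  proof unfold_locales
    show "closed ?S" by (rule closed_galerkin_space[OF basis])
    show "subspace ?S" unfolding galerkin_space_def by (rule subspace_span)
  qed (use f_S f_lip \<open>\<kappa> < 1\<close> g_meas[of 0] g_int in auto)
  have Z_Suc: "Z x (Suc m) \<omega> = f (Z x m \<omega>) + g m \<omega>" for x m \<omega>
    unfolding Z f_def g_def by simp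
  \<comment> \<open>This holds for arbitrary arguments, including the default values outside \<open>?S\<close> and for functions
    that are not integrable, so it can be used inside iterates of \<open>P\<close>.\<close>
  have P_eq: "P = chain.kernel_op"
  proof (intro ext)
    fix \<Phi> x
    have "Z x 1 \<omega> = f x + g 0 \<omega>" for \<omega>
      using Z_Suc[of x 0 \<omega>] by (simp add: Z)
    then show "P \<Phi> x = chain.kernel_op \<Phi> x"
      unfolding P transition_op_def chain.kernel_op_def by simp
  qed
  let ?G = "\<lambda>m. Ft (real m * \<tau>)" and ?Y = "Z (galerkin_proj e n X0)"
  have G: "subalgebra M (?G m)" for m
    using M(2) times(1)[of m] by (simp add: filtration_on_def)
  have G_mono: "subalgebra (?G (Suc m)) (?G m)" for m
    using M(2) times[of m] G[of m] G[of "Suc m"] unfolding filtration_on_def subalgebra_def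
    by (metis less_imp_le)
  have incr_G: "(\<lambda>\<omega>. incr m \<omega> i) \<in> borel_measurable (?G (Suc m))" for m i
  proof -
    have "B i (real k * \<tau>) \<in> borel_measurable (?G k)" for k
      using M(3) times(1)[of k] by (simp add: wiener_coordinates_def)
    from this[of "Suc m"] measurable_from_subalg[OF G_mono this[of m]]
    show ?thesis unfolding incr_def by (rule borel_measurable_diff)
  qed
  have g_G: "g m \<in> measurable (?G (Suc m)) ?N" for m
  proof -
    have "(\<lambda>\<omega>. incr m \<omega>) \<in> measurable (?G (Suc m)) (\<Pi>\<^sub>M i\<in>UNIV. borel)"
      using incr_G by (intro measurable_PiM_single') (auto simp: incr_def)
    then have "(\<lambda>\<omega>. \<psi> (incr m \<omega>)) \<in> measurable (?G (Suc m)) ?N"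
      by (rule measurable_compose) (rule \<psi>_meas, simp)
    then show ?thesis by (simp add: g_eq[abs_def])
  qed
  have Y_G: "?Y m \<in> measurable (?G m) ?N" for m
  proof (induction m)
    case 0
    have "?Y 0 = (\<lambda>_. galerkin_proj e n X0)" by (rule ext) (simp add: Z)
    then show ?case using galerkin_proj_mem[of e n X0] by (simp add: measurable_restrict_space2_iff)
  next
    case (Suc m)
    have "(\<lambda>\<omega>. f (?Y m \<omega>)) \<in> measurable (?G (Suc m)) ?N"
      by (rule measurable_compose[OF measurable_from_subalg[OF G_mono Suc] chain.f_measurable])
    from chain.add_measurable_N[OF this g_G] show ?case by (simp add: Z_Suc[abs_def])
  qed
  \<comment> \<open>The transition operator is defined by the first step, so all steps are compared with it.\<close>
  have law: "distr M ?N (g m) = distr M ?N (g 0)" for m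
  proof -
    let ?X = "\<lambda>m \<omega>. \<lambda>i\<in>{..<n}. incr m \<omega> i" and ?Pi = "\<Pi>\<^sub>M i\<in>{..<n}. (borel :: real measure)"
    have X: "?X m \<in> measurable M ?Pi" for m
      by (rule measurable_restrict) (rule incr_meas)
    have "g m = \<psi> \<circ> ?X m" for m
      by (rule ext) (simp add: g_eq \<psi>_def)
    then have eq: "distr M ?N (g m) = distr (distr M ?Pi (?X m)) ?N \<psi>" for m
      using distr_distr[OF \<psi>_meas[OF order_refl] X] by simp
    have "{..<n} \<noteq> {}" using n by (auto simp: lessThan_empty_iff)
    then have "distr M ?Pi (?X m) = distr M ?Pi (?X 0)"
      unfolding incr_def using times[of m] times[of 0]
      by (intro wiener_increments_same_law[OF M(1,3)]) simp_all
    then show ?thesis unfolding eq by simp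
  qed
  have indep: "indep_set (sets (?G m)) {g m -` A \<inter> space M |A. A \<in> sets ?N}" for m
  proof -
    let ?I = "{(\<lambda>\<omega> i. B i (real (Suc m) * \<tau>) \<omega> - B i (real m * \<tau>) \<omega>) -` A \<inter> space M |A. A \<in> sets (\<Pi>\<^sub>M i\<in>UNIV. borel)}"
    have "indep_set (sets (?G m)) ?I"
      using M(3) times(1,2)[of m] by (simp add: wiener_coordinates_def)
    moreover have "{g m -` A \<inter> space M |A. A \<in> sets ?N} \<subseteq> ?I"
    proof
      fix a assume "a \<in> {g m -` A \<inter> space M |A. A \<in> sets ?N}"
      then obtain A where A: "a = g m -` A \<inter> space M" "A \<in> sets ?N" by auto
      have "\<psi> -` A \<in> sets (\<Pi>\<^sub>M i\<in>UNIV. borel)"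
        using measurable_sets[OF \<psi>_meas[OF subset_UNIV] A(2)] by (simp add: space_PiM)
      moreover have "a = (\<lambda>\<omega> i. B i (real (Suc m) * \<tau>) \<omega> - B i (real m * \<tau>) \<omega>) -` (\<psi> -` A) \<inter> space M"
        unfolding A(1) by (auto simp: g_eq incr_def[abs_def])
      ultimately show "a \<in> ?I" by blast
    qed
    ultimately show ?thesis by (rule indep_set_subset)
  qed
  have "markov_chain_on M ?G ?S P ?Y"
    unfolding markov_chain_on_def P_eq Z_Suc
    using Y_G chain.real_cond_exp_step[OF G Y_G g_meas law indep] by blast
  moreover have "\<exists>\<nu>. invariant_prob ?S P \<nu> \<and> (\<forall>\<mu>. invariant_prob ?S P \<mu> \<longrightarrow> \<mu> = \<nu>) \<and> ergodic_wrt P \<nu>"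
    unfolding P_eq by (rule chain.ergodic_unique_invariant)
  ultimately show ?thesis by blast
qed

end
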